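(* For $0\le i\le N$ we have \begin{align*} U_i^{\downarrow\downarrow}&=(E^*_0V+E^*_1V+\cdots+E^*_iV)\cap(E_0V+E_1V+\cdots+E_{N-i}V),\\ U_i^{\uparrow\downarrow}&=(E^*_NV+E^*_{N-1}V+\cdots+E^*_iV)\cap(E_0V+E_1V+\cdots+E_{i}V),\\ U_i^{\downarrow\uparrow}&=(E^*_0V+E^*_1V+\cdots+E^*_iV)\cap(E_NV+E_{N-1}V+\cdots+E_{i}V),\\ U_i^{\uparrow\uparrow}&=(E^*_NV+E^*_{N-1}V+\cdots+E^*_iV)\cap(E_NV+E_{N-1}V+\cdots+E_{N-i}V). \end{align*}
   Context: Let $q$ be a prime power, $GF(q)$ the field with $q$ elements, $N\ge 1$ an integer, and $\mathbf V$ an $N$-dimensional vector space over $GF(q)$. Let $X$ be the set of all subspaces of $\mathbf V$, ordered by inclusion (the projective geometry $L_N(q)$). For $y,z\in X$, $y$ covers $z$ means $z\subseteq y$ and $\dim y-\dim z=1$. ${\rm Mat}_X(\mathbb C)$ is the algebra of complex matrices with rows and columns indexed by $X$; it acts on $V=\mathbb C^X$ by left multiplication. $A^*\in{\rm Mat}_X(\mathbb C)$ is the diagonal matrix with $(y,y)$-entry $q^{-\dim y}$. $R,L\in{\rm Mat}_X(\mathbb C)$: $R_{y,z}=1$ if $y$ covers $z$ and $0$ otherwise; $L_{y,z}=1$ if $z$ covers $y$ and $0$ otherwise. Fix a real number $\varphi>0$ and define \[ A=R+\varphi(A^* )^{-1}L+\frac{\varphi-1}{q-1}(A^* )^{-1},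 \] \[ A^+=\frac{(A^* )^{-1}}{q-1}-R,\quad A^-=\frac{(A^* )^{-1}}{q-1}+(A^* )^{-1}L,\quad A_+=\frac{(A^* )^{-1}}{q-1}+\varphi^{-1}R,\quad A_-=\frac{(A^* )^{-1}}{q-1}-\varphi(A^* )^{-1}L . \] For $0\le i\le N$: $E^*_i$ is the diagonal matrix with $(y,y)$-entry $1$ if $\dim y=i$ and $0$ otherwise. It is a fact that $A$ is diagonalizable with the mutually distinct eigenvalues $\theta_i=\frac{\varphi q^{N-i}-q^i}{q-1}$ $(0\le i\le N)$; $E_i$ denotes the matrix acting as the identity on the $\theta_i$-eigenspace of $A$ and as $0$ on the other eigenspaces, so $E_iV$ is the $\theta_i$-eigenspace of $A$. It is a fact that each of $A^-,A^+,A_-,A_+$ is diagonalizable with eigenvalues $q^i/(q-1)$ $(0\le i\le N)$; the eigenspace for $q^i/(q-1)$ is denoted $U_i^{\downarrow\downarrow}$ for $A^-$, $U_i^{\uparrow\downarrow}$ for $A^+$, $U_i^{\downarrow\uparrow}$ for $A_-$, and $U_i^{\uparrow\uparrow}$ for $A_+$. *)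

theory Defs
  imports "HOL-Analysis.Analysis" "HOL-Library.Set_Algebras"
begin

text \<open>
  The vector space over GF(q) is given by its scalar multiplication
  \<open>smul :: 'f \<Rightarrow> 'v \<Rightarrow> 'v\<close>, where \<open>'f\<close> is a finite field and
  \<open>q = CARD('f)\<close>.  The set X of all subspaces is represented by a finite index type
  \<open>'x\<close> together with a labelling \<open>sub :: 'x \<Rightarrow> 'v set\<close>, which the theorem assumes to be a
  bijection onto the set of all subspaces.  Hence \<open>complex ^ 'x ^ 'x\<close> is the matrix algebra
  indexed by X, and \<open>complex ^ 'x\<close> is the space of column vectors it acts on by \<open>*v\<close>.
\<close>

definition sdim :: "('f::field \<Rightarrow> 'v::ab_group_add \<Rightarrow> 'v) \<Rightarrow> ('x \<Rightarrow> 'v set) \<Rightarrow> 'x \<Rightarrow> nat" where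
  "sdim smul sub y = vector_space.dim smul (sub y)"

definition covers :: "('f::field \<Rightarrow> 'v::ab_group_add \<Rightarrow> 'v) \<Rightarrow> ('x \<Rightarrow> 'v set) \<Rightarrow> 'x \<Rightarrow> 'x \<Rightarrow> bool" where
  "covers smul sub y z \<longleftrightarrow> sub z \<subseteq> sub y \<and> sdim smul sub y = sdim smul sub z + 1"

definition Astar ::
  "('f::{field,finite} \<Rightarrow> 'v::ab_group_add \<Rightarrow> 'v) \<Rightarrow> ('x::finite \<Rightarrow> 'v set) \<Rightarrow> complex ^ 'x ^ 'x" where
  "Astar smul sub =
     (\<chi> y z. if y = z then 1 / of_nat CARD('f) ^ sdim smul sub y else 0)"

definition Rmat ::
  "('f::{field,finite} \<Rightarrow> 'v::ab_group_add \<Rightarrow> 'v) \<Rightarrow> ('x::finite \<Rightarrow> 'v set) \<Rightarrow> complex ^ 'x ^ 'x" where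
  "Rmat smul sub = (\<chi> y z. if covers smul sub y z then 1 else 0)"

definition Lmat ::
  "('f::{field,finite} \<Rightarrow> 'v::ab_group_add \<Rightarrow> 'v) \<Rightarrow> ('x::finite \<Rightarrow> 'v set) \<Rightarrow> complex ^ 'x ^ 'x" where
  "Lmat smul sub = (\<chi> y z. if covers smul sub z y then 1 else 0)"

definition Amat ::
  "('f::{field,finite} \<Rightarrow> 'v::ab_group_add \<Rightarrow> 'v) \<Rightarrow> ('x::finite \<Rightarrow> 'v set) \<Rightarrow> real \<Rightarrow> complex ^ 'x ^ 'x" where
  "Amat smul sub \<phi> =
     Rmat smul sub
     + \<phi> *\<^sub>R (matrix_inv (Astar smul sub) ** Lmat smul sub)
     + ((\<phi> - 1) / (real CARD('f) - 1)) *\<^sub>R matrix_inv (Astar smul sub)"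

text \<open>
  The four matrices \<open>A\<^sup>+, A\<^sup>-, A\<^sub>+, A\<^sub>-\<close>: the names say whether the sign is an upper or a
  lower index.
\<close>

definition A_upper_plus ::
  "('f::{field,finite} \<Rightarrow> 'v::ab_group_add \<Rightarrow> 'v) \<Rightarrow> ('x::finite \<Rightarrow> 'v set) \<Rightarrow> complex ^ 'x ^ 'x" where
  "A_upper_plus smul sub =
     (1 / (real CARD('f) - 1)) *\<^sub>R matrix_inv (Astar smul sub) - Rmat smul sub"

definition A_upper_minus ::
  "('f::{field,finite} \<Rightarrow> 'v::ab_group_add \<Rightarrow> 'v) \<Rightarrow> ('x::finite \<Rightarrow> 'v set) \<Rightarrow> complex ^ 'x ^ 'x" where
  "A_upper_minus smul sub =
     (1 / (real CARD('f) - 1)) *\<^sub>R matrix_inv (Astar smul sub)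
     + matrix_inv (Astar smul sub) ** Lmat smul sub"

definition A_lower_plus ::
  "('f::{field,finite} \<Rightarrow> 'v::ab_group_add \<Rightarrow> 'v) \<Rightarrow> ('x::finite \<Rightarrow> 'v set) \<Rightarrow> real \<Rightarrow> complex ^ 'x ^ 'x" where
  "A_lower_plus smul sub \<phi> =
     (1 / (real CARD('f) - 1)) *\<^sub>R matrix_inv (Astar smul sub)
     + inverse \<phi> *\<^sub>R Rmat smul sub"

definition A_lower_minus ::
  "('f::{field,finite} \<Rightarrow> 'v::ab_group_add \<Rightarrow> 'v) \<Rightarrow> ('x::finite \<Rightarrow> 'v set) \<Rightarrow> real \<Rightarrow> complex ^ 'x ^ 'x" where
  "A_lower_minus smul sub \<phi> =
     (1 / (real CARD('f) - 1)) *\<^sub>R matrix_inv (Astar smul sub)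
     - \<phi> *\<^sub>R (matrix_inv (Astar smul sub) ** Lmat smul sub)"

definition Estar ::
  "('f::{field,finite} \<Rightarrow> 'v::ab_group_add \<Rightarrow> 'v) \<Rightarrow> ('x::finite \<Rightarrow> 'v set) \<Rightarrow> nat \<Rightarrow> complex ^ 'x ^ 'x" where
  "Estar smul sub i = (\<chi> y z. if y = z \<and> sdim smul sub y = i then 1 else 0)"

definition eigenspace :: "complex ^ 'x ^ 'x \<Rightarrow> complex \<Rightarrow> (complex ^ 'x::finite) set" where
  "eigenspace M c = {v. M *v v = c *s v}"

definition theta :: "nat \<Rightarrow> nat \<Rightarrow> real \<Rightarrow> nat \<Rightarrow> complex" where
  "theta q N \<phi> i = of_real ((\<phi> * real q ^ (N - i) - real q ^ i) / (real q - 1))"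

text \<open>
  \<open>Emat\<close> is well defined because A is diagonalizable with the mutually distinct eigenvalues
  \<open>theta q N \<phi> i\<close> for \<open>i \<le> N\<close>, so that its eigenspaces span the whole space.
\<close>

definition Emat ::
  "('f::{field,finite} \<Rightarrow> 'v::ab_group_add \<Rightarrow> 'v) \<Rightarrow> ('x::finite \<Rightarrow> 'v set) \<Rightarrow> nat \<Rightarrow> real \<Rightarrow> nat
    \<Rightarrow> complex ^ 'x ^ 'x" where
  "Emat smul sub N \<phi> i =
     (THE P. (\<forall>v \<in> eigenspace (Amat smul sub \<phi>) (theta CARD('f) N \<phi> i). P *v v = v) \<and>
             (\<forall>j \<le> N. j \<noteq> i \<longrightarrow>
                (\<forall>v \<in> eigenspace (Amat smul sub \<phi>) (theta CARD('f) N \<phi> j). P *v v = 0)))"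

text \<open>
  \<open>matrix_range M\<close> is MV for V = \<open>complex ^ 'x\<close>.  Sums of such sets are elementwise sums,
  as provided by \<open>HOL-Library.Set_Algebras\<close>; for linear subspaces this is the usual sum.
\<close>

definition matrix_range :: "complex ^ 'x ^ 'x \<Rightarrow> (complex ^ 'x::finite) set" where
  "matrix_range M = range (\<lambda>v. M *v v)"

text \<open>
  The common eigenvalue \<open>q\<^sup>i / (q - 1)\<close> of the four matrices above.  In the names of the
  eigenspaces, \<open>d\<close> and \<open>u\<close> stand for the arrows down and up, in the order of the superscript.
\<close>

definition mu :: "nat \<Rightarrow> nat \<Rightarrow> complex" where
  "mu q i = of_nat q ^ i / (of_nat q - 1)"

definition U_dd ::
  "('f::{field,finite} \<Rightarrow> 'v::ab_group_add \<Rightarrow> 'v) \<Rightarrow> ('x::finite \<Rightarrow> 'v set) \<Rightarrow> nat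
    \<Rightarrow> (complex ^ 'x) set" where
  "U_dd smul sub i = eigenspace (A_upper_minus smul sub) (mu CARD('f) i)"

definition U_ud ::
  "('f::{field,finite} \<Rightarrow> 'v::ab_group_add \<Rightarrow> 'v) \<Rightarrow> ('x::finite \<Rightarrow> 'v set) \<Rightarrow> nat
    \<Rightarrow> (complex ^ 'x) set" where
  "U_ud smul sub i = eigenspace (A_upper_plus smul sub) (mu CARD('f) i)"

definition U_du ::
  "('f::{field,finite} \<Rightarrow> 'v::ab_group_add \<Rightarrow> 'v) \<Rightarrow> ('x::finite \<Rightarrow> 'v set) \<Rightarrow> real \<Rightarrow> nat
    \<Rightarrow> (complex ^ 'x) set" where
  "U_du smul sub \<phi> i = eigenspace (A_lower_minus smul sub \<phi>) (mu CARD('f) i)"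

definition U_uu ::
  "('f::{field,finite} \<Rightarrow> 'v::ab_group_add \<Rightarrow> 'v) \<Rightarrow> ('x::finite \<Rightarrow> 'v set) \<Rightarrow> real \<Rightarrow> nat
    \<Rightarrow> (complex ^ 'x) set" where
  "U_uu smul sub \<phi> i = eigenspace (A_lower_plus smul sub \<phi>) (mu CARD('f) i)"

end

theory Submission
  imports Defs
begin

text \<open>
  Put \<open>K = (A\<^sup>*)\<^sup>-\<^sup>1\<close>. Counting covers in the subspace lattice gives \<open>K R = q R K\<close>, \<open>L K = q K L\<close> and
  \<open>L R - R L = (q\<^sup>N K\<^sup>-\<^sup>1 - K) / (q - 1)\<close>. Hence the pairs \<open>(P, M) = (A\<^sup>+, A\<^sup>-)\<close> and
  \<open>(P, M) = (A\<^sub>+, A\<^sub>-)\<close> both satisfy \<open>q P M - M P = q\<^sup>N / (q - 1)\<close>, while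
  \<open>A = \<phi> A\<^sup>- - A\<^sup>+ = \<phi> A\<^sub>+ - A\<^sub>-\<close>. So, for \<open>B\<close> any of the four matrices and \<open>U\<^sub>i\<close> its eigenspaces,
  \<open>A - \<theta>\<close> maps \<open>U\<^sub>i\<close> to a neighbouring \<open>U\<^sub>i\<^sub>\<plusminus>\<^sub>1\<close> for a suitable eigenvalue \<open>\<theta>\<close> of \<open>A\<close>: that is, \<open>A\<close> is
  triangular with respect to the \<open>U\<^sub>i\<close>, just as \<open>B\<close> is triangular with respect to the \<open>E\<^sup>*\<^sub>iV\<close>.
  A matrix that is triangular with distinct diagonal values is diagonalizable, and the flag is
  spanned by its eigenspaces. Thus the sums of the \<open>E\<^sup>*\<^sub>jV\<close> and of the \<open>E\<^sub>jV\<close> in question are the two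
  opposite partial sums of the \<open>U\<^sub>j\<close>, which meet in \<open>U\<^sub>i\<close>.
\<close>

section \<open>Eigenspaces and flags\<close>

lemma eigenspace_subspace: "vec.subspace (eigenspace M c)"
  by (auto simp: vec.subspace_def eigenspace_def matrix_vector_right_distrib
      vector_scalar_commute vector_add_ldistrib mult.commute)

lemma mem_set_sum_iff:
  assumes "finite I"
  shows "v \<in> (\<Sum>i\<in>I. S i) \<longleftrightarrow> (\<exists>f. (\<forall>i\<in>I. f i \<in> S i) \<and> v = (\<Sum>i\<in>I. f i))"
  by (auto simp: set_sum_alt[OF assms])

lemma set_sumE:
  assumes "v \<in> (\<Sum>i\<in>I. S i)" "finite I"
  obtains f where "\<And>i. i \<in> I \<Longrightarrow> f i \<in> S i" "v = (\<Sum>i\<in>I. f i)"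
  using assms by (auto simp: mem_set_sum_iff)

lemma subspace_set_sum:
  fixes S :: "'i \<Rightarrow> ('a::field ^ 'n::finite) set"
  assumes "\<And>i. i \<in> I \<Longrightarrow> vec.subspace (S i)"
  shows "vec.subspace (\<Sum>i\<in>I. S i)"
proof (cases "finite I")
  case True
  then show ?thesis using assms
  proof (induction I)
    case empty
    then show ?case by (simp add: vec.subspace_def set_zero)
  next
    case (insert i I)
    have "A + B = {x + y |x y. x \<in> A \<and> y \<in> B}" for A B :: "('a ^ 'n) set"
      by (auto simp: set_plus_def)
    with insert show ?case by (simp add: vec.subspace_sums)
  qed
next
  case False
  \<comment> \<open>A sum over an infinite index set is \<open>0\<close> by convention, which for
    sets is \<open>{0}\<close>.\<close>
  then show ?thesis by (simp add: vec.subspace_def set_zero)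
qed

text \<open>Induction on \<open>J\<close>: applying \<open>M - t k\<close> to the vanishing sum
  removes the new term and multiplies each other \<open>f i\<close> by the nonzero
  \<open>t i - t k\<close>. The rescaled family falls under the induction hypothesis.\<close>

lemma eigenvectors_independent:
  assumes "finite J" "inj_on t J" "\<And>j. j \<in> J \<Longrightarrow> f j \<in> eigenspace M (t j)"
    and "(\<Sum>j\<in>J. f j) = 0" "j \<in> J"
  shows "f j = 0"
  using assms
proof (induction J arbitrary: f j)
  case empty
  then show ?case by simp
next
  case (insert k J)
  have M: "M *v f i = t i *s f i" if "i \<in> insert k J" for i
    using insert.prems(2)[OF that] by (simp add: eigenspace_def)
  have fk: "f k = - (\<Sum>i\<in>J. f i)"
    using insert by (simp add: add_eq_0_iff2)
  have "(\<Sum>i\<in>J. (t i - t k) *s f i) = M *v (\<Sum>i\<in>insert k J. f i) - t k *s (\<Sum>i\<in>insert k J. f i)"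
    using insert.hyps
    by (simp add: vec.linear_sum[OF matrix_vector_mul_linear_gen] M matrix_vector_right_distrib
        vec.scale_sum_right vec.scale_left_diff_distrib sum_subtractf vec.scale_right_distrib)
  then have "(\<Sum>i\<in>J. (t i - t k) *s f i) = 0"
    using insert.prems by simp
  moreover have "(t i - t k) *s f i \<in> eigenspace M (t i)" if "i \<in> J" for i
    using insert.prems(2)[of i] that by (simp add: eigenspace_subspace vec.subspace_scale del: vector_sub_rdistrib)
  ultimately have "(t i - t k) *s f i = 0" if "i \<in> J" for i
    using insert.IH[of "\<lambda>i. (t i - t k) *s f i" i] insert.prems(1) that by auto
  moreover have "t i \<noteq> t k" if "i \<in> J" for i
    using insert.prems(1) insert.hyps that by (auto simp: inj_on_def)
  ultimately have "f i = 0" if "i \<in> J" for i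
    using that by fastforce
  with fk insert.prems(4) show ?case by auto
qed

text \<open>Go down the flag: \<open>M - t m\<close> is invertible on the eigenspaces that make up
  \<open>F (Suc m)\<close>, so a vector of \<open>F m\<close> can be corrected by an element of
  \<open>F (Suc m)\<close> into an eigenvector for \<open>t m\<close>. Conversely, an eigenvector
  for \<open>t j\<close> that lies in \<open>F m\<close> with \<open>m < j\<close> sinks into
  \<open>F (Suc m)\<close>, because \<open>t j - t m\<close> is nonzero.\<close>

lemma filtration_eigenspaces:
  fixes M :: "complex ^ 'x ^ 'x::finite"
  assumes sub: "\<And>m. vec.subspace (F m)"
    and F0: "F 0 = UNIV" and FN: "F (Suc N) = {0}"
    and dec: "\<And>m. m \<le> N \<Longrightarrow> F (Suc m) \<subseteq> F m"
    and step: "\<And>m v. m \<le> N \<Longrightarrow> v \<in> F m \<Longrightarrow> M *v v - t m *s v \<in> F (Suc m)"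
    and inj: "inj_on t {..N}"
    and m: "m \<le> Suc N"
  shows "F m = (\<Sum>k=m..N. eigenspace M (t k))"
proof
  show "F m \<subseteq> (\<Sum>k=m..N. eigenspace M (t k))"
    using m
  proof (induction rule: inc_induct)
    case base
    then show ?case by (simp add: FN flip: set_zero)
  next
    case (step m)
    show ?case
    proof
      fix v assume v: "v \<in> F m"
      have m: "m \<le> N" using step by simp
      have "M *v v - t m *s v \<in> (\<Sum>k=Suc m..N. eigenspace M (t k))"
        using assms(5)[OF m v] step.IH by blast
      then obtain f where f: "\<And>k. k \<in> {Suc m..N} \<Longrightarrow> f k \<in> eigenspace M (t k)"
        and Mv: "M *v v - t m *s v = (\<Sum>k=Suc m..N. f k)"
        by (rule set_sumE) auto
      \<comment> \<open>On \<open>f k\<close> the map \<open>M - t m\<close> is the scalar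
        \<open>t k - t m\<close>; dividing termwise by it gives a preimage of
        \<open>M *v v - t m *s v\<close>.\<close>
      define z where "z = (\<Sum>k=Suc m..N. inverse (t k - t m) *s f k)"
      have z: "z \<in> (\<Sum>k=Suc m..N. eigenspace M (t k))"
        unfolding z_def
        by (subst mem_set_sum_iff)
           (auto intro!: exI[of _ "\<lambda>k. inverse (t k - t m) *s f k"] vec.subspace_scale
             eigenspace_subspace f)
      have ne: "t k \<noteq> t m" if "k \<in> {Suc m..N}" for k
        using inj_onD[OF inj, of k m] that m by auto
      have "M *v z - t m *s z = (\<Sum>k=Suc m..N. inverse (t k - t m) *s (M *v f k - t m *s f k))"
        unfolding z_def
        by (simp add: vec.linear_sum[OF matrix_vector_mul_linear_gen] vec.scale_sum_right
            sum_subtractf vector_scalar_commute vec.scale_right_diff_distrib mult.commute)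
      also have "\<dots> = (\<Sum>k=Suc m..N. f k)"
      proof (intro sum.cong refl)
        fix k assume k: "k \<in> {Suc m..N}"
        have "M *v f k - t m *s f k = (t k - t m) *s f k"
          using f[OF k] by (simp add: eigenspace_def vec.scale_left_diff_distrib)
        then show "inverse (t k - t m) *s (M *v f k - t m *s f k) = f k"
          using ne[OF k] by (simp del: vector_sub_rdistrib)
      qed
      finally have "M *v z - t m *s z = M *v v - t m *s v"
        using Mv by simp
      then have "v - z \<in> eigenspace M (t m)"
        by (simp add: eigenspace_def algebra_simps vec.scale_right_diff_distrib)
      then have "(v - z) + z \<in> eigenspace M (t m) + (\<Sum>k=Suc m..N. eigenspace M (t k))"
        using z by blast
      then show "v \<in> (\<Sum>k=m..N. eigenspace M (t k))"
        using m by (simp add: sum.atLeast_Suc_atMost)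
    qed
  qed
next
  have inv: "M *v r - c *s r \<in> F m" if "r \<in> F m" "m \<le> Suc N" for c r m
  proof (cases "m = Suc N")
    case True
    with that FN show ?thesis by simp
  next
    case False
    then have "m \<le> N" using that by simp
    then have "M *v r - t m *s r \<in> F m" using step[of m r] dec[of m] that by blast
    then have "(M *v r - t m *s r) + (t m - c) *s r \<in> F m"
      using that sub by (intro vec.subspace_add vec.subspace_scale)
    then show ?thesis by (simp add: vec.scale_left_diff_distrib)
  qed
  have eig: "eigenspace M (t j) \<subseteq> F m" if "m \<le> j" "j \<le> N" for j
    using that(1)
  proof (induction m)
    case 0
    then show ?case by (simp add: F0)
  next
    case (Suc m)
    show ?case
    proof
      fix v assume v: "v \<in> eigenspace M (t j)"
      have m: "m \<le> N" using Suc that by simp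
      have "M *v v - t m *s v \<in> F (Suc m)"
        using Suc v m by (intro step) auto
      then have "(t j - t m) *s v \<in> F (Suc m)"
        using v by (simp add: eigenspace_def vec.scale_left_diff_distrib)
      then have "inverse (t j - t m) *s ((t j - t m) *s v) \<in> F (Suc m)"
        by (rule vec.subspace_scale[OF sub])
      moreover have "t j \<noteq> t m"
        using inj_onD[OF inj, of j m] m that Suc.prems by auto
      ultimately show "v \<in> F (Suc m)" by (simp del: vector_sub_rdistrib)
    qed
  qed
  show "(\<Sum>k=m..N. eigenspace M (t k)) \<subseteq> F m"
    using eig by (fastforce simp: mem_set_sum_iff intro!: vec.subspace_sum sub)
qed

text \<open>Two uses of \<open>filtration_eigenspaces\<close>: for \<open>B\<close> on the flag
  given by the levels \<open>l\<close>, and for \<open>A\<close> on the sums of eigenspaces of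
  \<open>B\<close> with index at least \<open>m\<close>. Injectivity of \<open>\<nu>\<close> up to
  \<open>Suc N\<close> ensures that \<open>\<nu> (Suc N)\<close> is no eigenvalue of
  \<open>B\<close>, so the raising by \<open>A\<close> stops at index \<open>N\<close>.\<close>

lemma eigenspace_split:
  fixes A B :: "complex ^ 'x ^ 'x::finite" and \<nu> \<tau> :: "nat \<Rightarrow> complex" and l :: "'x \<Rightarrow> nat"
  assumes l: "\<And>y. l y \<le> N"
    and B_diag: "\<And>y. B $ y $ y = \<nu> (l y)"
    and B_tri: "\<And>y z. y \<noteq> z \<Longrightarrow> B $ y $ z \<noteq> 0 \<Longrightarrow> l y < l z"
    and A: "\<And>k v. k \<le> N \<Longrightarrow> v \<in> eigenspace B (\<nu> k) \<Longrightarrow>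
          A *v v - \<tau> k *s v \<in> eigenspace B (\<nu> (Suc k))"
    and inj_nu: "inj_on \<nu> {..Suc N}" and inj_tau: "inj_on \<tau> {..N}"
  shows "(\<Sum>k=0..N. eigenspace A (\<tau> k)) = UNIV"
    and "i \<le> N \<Longrightarrow> eigenspace B (\<nu> i) =
      {v. \<forall>y. v $ y \<noteq> 0 \<longrightarrow> l y \<le> i} \<inter> (\<Sum>k=i..N. eigenspace A (\<tau> k))"
proof -
  \<comment> \<open>Writing \<open>l y + m \<le> N\<close> instead of \<open>l y \<le> N - m\<close>
    makes \<open>F (Suc N)\<close> the zero space despite truncated subtraction.\<close>
  define F where "F m = {v :: complex ^ 'x. \<forall>y. v $ y \<noteq> 0 \<longrightarrow> l y + m \<le> N}" for m
  have inj': "inj_on (\<lambda>m. \<nu> (N - m)) {..N}"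
    by (intro inj_onI) (force dest: inj_onD[OF inj_nu])
  have F: "F m = (\<Sum>k=m..N. eigenspace B (\<nu> (N - k)))" if "m \<le> Suc N" for m
  proof (rule filtration_eigenspaces[OF _ _ _ _ _ inj' that])
    show "vec.subspace (F m)" for m
      by (auto simp: vec.subspace_def F_def) (metis add_0)
    show "F 0 = UNIV" using l by (auto simp: F_def)
    show "F (Suc N) = {0}" by (auto simp: F_def vec_eq_iff)
    show "F (Suc m) \<subseteq> F m" for m by (auto simp: F_def)
    show "B *v v - \<nu> (N - m) *s v \<in> F (Suc m)" if m: "m \<le> N" and v: "v \<in> F m" for m v
      unfolding F_def
    proof (intro CollectI allI impI)
      fix y assume ne: "(B *v v - \<nu> (N - m) *s v) $ y \<noteq> 0"
      \<comment> \<open>The diagonal term vanishes at level \<open>N - m\<close>, and every other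
        nonzero term comes from some \<open>z\<close> with \<open>l y < l z\<close>; either way
        \<open>l y\<close> lies strictly below the bound for \<open>v\<close>.\<close>
      have "(B *v v - \<nu> (N - m) *s v) $ y
          = (\<nu> (l y) - \<nu> (N - m)) * v $ y + (\<Sum>z\<in>UNIV - {y}. B $ y $ z * v $ z)"
        by (simp add: matrix_vector_mult_def sum.remove[of UNIV y] B_diag algebra_simps)
      with ne consider "\<nu> (l y) \<noteq> \<nu> (N - m)" "v $ y \<noteq> 0"
        | z where "z \<noteq> y" "B $ y $ z \<noteq> 0" "v $ z \<noteq> 0"
        by (metis (no_types, lifting) DiffD2 add_0 diff_self insertCI mult_eq_0_iff sum.neutral)
      then show "l y + Suc m \<le> N"
      proof cases
        case 1
        then have "l y + m \<le> N" "l y \<noteq> N - m" using v by (auto simp: F_def)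
        then show ?thesis by simp
      next
        case (2 z)
        then show ?thesis using B_tri[of y z] v by (fastforce simp: F_def)
      qed
    qed
  qed
  have low: "{v. \<forall>y. v $ y \<noteq> 0 \<longrightarrow> l y \<le> i} = (\<Sum>k=0..i. eigenspace B (\<nu> k))" if "i \<le> N" for i
  proof -
    have "{v :: complex ^ 'x. \<forall>y. v $ y \<noteq> 0 \<longrightarrow> l y \<le> i} = F (N - i)"
      using that by (auto simp: F_def)
    also have "\<dots> = (\<Sum>k=N-i..N. eigenspace B (\<nu> (N - k)))"
      by (rule F) simp
    also have "\<dots> = (\<Sum>k=0..i. eigenspace B (\<nu> k))"
      by (rule sum.reindex_bij_witness[of _ "\<lambda>k. N - k" "\<lambda>k. N - k"]) (use that in auto)
    finally show ?thesis .
  qed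
  have allB: "(\<Sum>k=0..N. eigenspace B (\<nu> k)) = UNIV"
    using low[of N] l by auto
  have extra: "eigenspace B (\<nu> (Suc N)) = {0}"
  proof -
    have "v = 0" if v: "v \<in> eigenspace B (\<nu> (Suc N))" for v
    proof -
      have "v \<in> (\<Sum>k=0..N. eigenspace B (\<nu> k))" using allB by simp
      then obtain f where f: "\<And>k. k \<in> {0..N} \<Longrightarrow> f k \<in> eigenspace B (\<nu> k)" "v = (\<Sum>k=0..N. f k)"
        by (rule set_sumE) auto
      \<comment> \<open>Appending \<open>- v\<close> with eigenvalue \<open>\<nu> (Suc N)\<close> to
        the decomposition of \<open>v\<close> gives a vanishing sum of eigenvectors for distinct
        eigenvalues.\<close>
      define g where "g k = (if k = Suc N then - v else f k)" for k
      have "g (Suc N) = 0"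
        by (rule eigenvectors_independent[of "{..Suc N}" \<nu> g B])
           (use inj_nu f v vec.subspace_neg[OF eigenspace_subspace] in
             \<open>auto simp: g_def atMost_Suc atLeast0AtMost intro!: sum.cong\<close>)
      then show ?thesis by (simp add: g_def)
    qed
    then show ?thesis using vec.subspace_0[OF eigenspace_subspace] by blast
  qed
  have high: "(\<Sum>k=m..N. eigenspace B (\<nu> k)) = (\<Sum>k=m..N. eigenspace A (\<tau> k))" if "m \<le> Suc N" for m
  proof (rule filtration_eigenspaces[OF _ _ _ _ _ inj_tau that])
    show sub: "vec.subspace (\<Sum>k=m..N. eigenspace B (\<nu> k))" for m
      by (intro subspace_set_sum eigenspace_subspace)
    show "(\<Sum>k=0..N. eigenspace B (\<nu> k)) = UNIV" by (fact allB)
    show "(\<Sum>k=Suc N..N. eigenspace B (\<nu> k)) = {0}" by (simp flip: set_zero)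
    show dec: "(\<Sum>k=Suc m..N. eigenspace B (\<nu> k)) \<subseteq> (\<Sum>k=m..N. eigenspace B (\<nu> k))" if "m \<le> N" for m
      using that
      by (simp add: sum.atLeast_Suc_atMost set_zero_plus2 vec.subspace_0[OF eigenspace_subspace])
    show "A *v v - \<tau> m *s v \<in> (\<Sum>k=Suc m..N. eigenspace B (\<nu> k))"
      if "m \<le> N" "v \<in> (\<Sum>k=m..N. eigenspace B (\<nu> k))" for m v
    proof -
      have one: "eigenspace B (\<nu> k) \<subseteq> (\<Sum>k=m..N. eigenspace B (\<nu> k))" if "m \<le> k" "k \<le> N" for k m
      proof
        fix w assume "w \<in> eigenspace B (\<nu> k)"
        then show "w \<in> (\<Sum>k=m..N. eigenspace B (\<nu> k))"
          using that vec.subspace_0[OF eigenspace_subspace]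
          by (auto simp: mem_set_sum_iff intro!: exI[of _ "\<lambda>j. if j = k then w else 0"])
      qed
      obtain f where f: "\<And>k. k \<in> {m..N} \<Longrightarrow> f k \<in> eigenspace B (\<nu> k)" "v = (\<Sum>k=m..N. f k)"
        using \<open>v \<in> _\<close> by (rule set_sumE) auto
      \<comment> \<open>On the summand \<open>f k\<close>, split \<open>A - \<tau> m\<close> into
        \<open>A - \<tau> k\<close>, which moves to index \<open>Suc k\<close>, and a scalar, which
        is zero at \<open>k = m\<close>. For \<open>k = N\<close> the target of the move is zero by
        \<open>extra\<close>.\<close>
      have "A *v v - \<tau> m *s v = (\<Sum>k=m..N. (A *v f k - \<tau> k *s f k) + (\<tau> k - \<tau> m) *s f k)"
        unfolding f(2)
        by (simp add: vec.linear_sum[OF matrix_vector_mul_linear_gen] vec.scale_sum_right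
            vec.scale_left_diff_distrib sum_subtractf)
      also have "\<dots> \<in> (\<Sum>k=Suc m..N. eigenspace B (\<nu> k))"
      proof (intro vec.subspace_sum sub vec.subspace_add)
        fix k assume k: "k \<in> {m..N}"
        have "A *v f k - \<tau> k *s f k \<in> eigenspace B (\<nu> (Suc k))"
          using A f k by auto
        then show "A *v f k - \<tau> k *s f k \<in> (\<Sum>k=Suc m..N. eigenspace B (\<nu> k))"
          using one[of "Suc m" "Suc k"] extra k sub[of "Suc m"]
          by (cases "k = N") (auto simp del: sum.atLeast_Suc_atMost intro: vec.subspace_0)
        show "(\<tau> k - \<tau> m) *s f k \<in> (\<Sum>k=Suc m..N. eigenspace B (\<nu> k))"
        proof (cases "k = m")
          case True
          then show ?thesis using sub by (simp add: vec.subspace_0)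
        next
          case False
          then have "f k \<in> (\<Sum>k=Suc m..N. eigenspace B (\<nu> k))"
            using one[of "Suc m" k] f(1) k by auto
          then show ?thesis by (intro vec.subspace_scale sub)
        qed
      qed
      finally show ?thesis .
    qed
  qed
  show "(\<Sum>k=0..N. eigenspace A (\<tau> k)) = UNIV"
    using high[of 0] allB by simp
  show "eigenspace B (\<nu> i) =
      {v. \<forall>y. v $ y \<noteq> 0 \<longrightarrow> l y \<le> i} \<inter> (\<Sum>k=i..N. eigenspace A (\<tau> k))" if i: "i \<le> N"
  proof -
    have "eigenspace B (\<nu> i) = (\<Sum>k=0..i. eigenspace B (\<nu> k)) \<inter> (\<Sum>k=i..N. eigenspace B (\<nu> k))"
    proof (intro equalityI subsetI)
      fix v assume "v \<in> eigenspace B (\<nu> i)"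
      then show "v \<in> (\<Sum>k=0..i. eigenspace B (\<nu> k)) \<inter> (\<Sum>k=i..N. eigenspace B (\<nu> k))"
        using i vec.subspace_0[OF eigenspace_subspace]
        by (auto simp: mem_set_sum_iff intro!: exI[of _ "\<lambda>j. if j = i then v else 0"])
    next
      fix v assume "v \<in> (\<Sum>k=0..i. eigenspace B (\<nu> k)) \<inter> (\<Sum>k=i..N. eigenspace B (\<nu> k))"
      then have v: "v \<in> (\<Sum>k=0..i. eigenspace B (\<nu> k))" "v \<in> (\<Sum>k=i..N. eigenspace B (\<nu> k))"
        by auto
      obtain f where f: "\<And>k. k \<in> {0..i} \<Longrightarrow> f k \<in> eigenspace B (\<nu> k)" "v = (\<Sum>k=0..i. f k)"
        using v(1) by (rule set_sumE) auto
      obtain g where g: "\<And>k. k \<in> {i..N} \<Longrightarrow> g k \<in> eigenspace B (\<nu> k)" "v = (\<Sum>k=i..N. g k)"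
        using v(2) by (rule set_sumE) auto
      \<comment> \<open>The two decompositions of \<open>v\<close>, extended by zero and subtracted,
        form a vanishing sum. For \<open>k < i\<close> its term is \<open>f k\<close>, so only
        \<open>f i\<close> survives.\<close>
      define h where "h k = (if k \<le> i then f k else 0) - (if i \<le> k then g k else 0)" for k
      have "(\<Sum>k\<le>N. if k \<le> i then f k else 0) = v"
        unfolding f(2) by (intro sum.mono_neutral_cong_right) (use i in auto)
      moreover have "(\<Sum>k\<le>N. if i \<le> k then g k else 0) = v"
        unfolding g(2) by (intro sum.mono_neutral_cong_right) auto
      ultimately have "(\<Sum>k\<le>N. h k) = 0" by (simp add: h_def sum_subtractf)
      moreover have "h k \<in> eigenspace B (\<nu> k)" if "k \<in> {..N}" for k
        using that f(1) g(1) unfolding h_def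
        by (intro vec.subspace_diff eigenspace_subspace)
           (auto simp: vec.subspace_0[OF eigenspace_subspace])
      ultimately have h0: "h k = 0" if "k \<le> N" for k
        using eigenvectors_independent[of "{..N}" \<nu> h B k] inj_nu that
        by (auto simp: inj_on_def)
      have "f k = 0" if "k < i" for k
        using h0[of k] that i by (simp add: h_def)
      then have "v = f i"
        unfolding f(2) by (simp add: sum.last_plus)
      with f(1)[of i] show "v \<in> eigenspace B (\<nu> i)" by simp
    qed
    then show ?thesis using low[OF i] high[of i] i by simp
  qed
qed

section \<open>Covers in the lattice of subspaces\<close>

locale finite_geometry = finite_dimensional_vector_space scale Basis
  for scale :: "'f::{field,finite} \<Rightarrow> 'v::ab_group_add \<Rightarrow> 'v" (infixr "*s" 75)
    and Basis :: "'v set"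
begin

text \<open>An element of \<open>span (insert b B)\<close> is \<open>c *s b + v\<close> for a unique
  scalar \<open>c\<close> and a unique \<open>v\<close> in \<open>span B\<close>, so each new basis
  vector multiplies the size by \<open>CARD('f)\<close>.\<close>

lemma card_span:
  assumes "finite B" "independent B"
  shows "finite (span B)" and "card (span B) = CARD('f) ^ card B"
proof -
  have "finite (span B) \<and> card (span B) = CARD('f) ^ card B"
    using assms
  proof (induction B)
    case empty
    then show ?case by simp
  next
    case (insert b B)
    have b: "b \<notin> span B" and B: "independent B"
      using insert.prems insert.hyps by (simp_all add: independent_insert)
    have "bij_betw (\<lambda>(c, v). c *s b + v) (UNIV \<times> span B) (span (insert b B))"
      unfolding bij_betw_def
    proof
      show "inj_on (\<lambda>(c, v). c *s b + v) (UNIV \<times> span B)"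
      proof (rule inj_onI, clarsimp)
        fix c v d w assume v: "v \<in> span B" and w: "w \<in> span B" and eq: "c *s b + v = d *s b + w"
        then have "(c - d) *s b = w - v"
          by (simp add: scale_left_diff_distrib algebra_simps)
        then have "(c - d) *s b \<in> span B" using v w by (simp add: span_diff)
        then have "inverse (c - d) *s ((c - d) *s b) \<in> span B" by (rule span_scale)
        then have "c = d" using b by (cases "c = d") auto
        then show "c = d \<and> v = w" using eq by simp
      qed
      show "(\<lambda>(c, v). c *s b + v) ` (UNIV \<times> span B) = span (insert b B)"
      proof (intro equalityI subsetI)
        fix x assume "x \<in> span (insert b B)"
        then obtain c where "x - c *s b \<in> span B" by (auto simp: span_insert)
        then show "x \<in> (\<lambda>(c, v). c *s b + v) ` (UNIV \<times> span B)"
          by (intro image_eqI[of _ _ "(c, x - c *s b)"]) auto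
      next
        fix x assume "x \<in> (\<lambda>(c, v). c *s b + v) ` (UNIV \<times> span B)"
        then obtain c v where "v \<in> span B" "x = c *s b + v" by auto
        then show "x \<in> span (insert b B)"
          by (auto simp: span_insert intro!: exI[of _ c])
      qed
    qed
    with insert B show ?case
      by (auto simp: card_cartesian_product dest: bij_betw_same_card bij_betw_finite)
  qed
  then show "finite (span B)" and "card (span B) = CARD('f) ^ card B" by auto
qed

lemma finite_UNIV_vectors: "finite (UNIV :: 'v set)"
  using card_span(1)[OF finite_Basis independent_Basis] by (simp add: span_Basis)

lemma finite_vectors [simp]: "finite (S :: 'v set)"
  using finite_UNIV_vectors by (rule finite_subset[rotated]) simp

lemma card_subspace: "subspace S \<Longrightarrow> card S = CARD('f) ^ dim S"
proof -
  assume S: "subspace S"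
  obtain B where B: "B \<subseteq> S" "independent B" "S \<subseteq> span B" "card B = dim S"
    using basis_exists by blast
  then have "span B = S" using S by (simp add: span_subspace)
  then show ?thesis using card_span(2)[of B] B by simp
qed

lemma q_gt_1: "1 < CARD('f)"
proof -
  have "card {0, 1 :: 'f} \<le> CARD('f)" by (rule card_mono) auto
  then show ?thesis by simp
qed

lemma dim_insert_notin:
  assumes "subspace Y" "v \<notin> Y"
  shows "dim (insert v Y) = Suc (dim Y)"
  using assms by (simp add: dim_insert span_eq_iff[THEN iffD2])

lemma span_insert_eq:
  assumes "subspace X" "subspace Y" "Y \<subseteq> X" "dim X = Suc (dim Y)" "v \<in> X" "v \<notin> Y"
  shows "span (insert v Y) = X"
proof (rule subspace_dim_equal)
  show "span (insert v Y) \<subseteq> X" using assms by (intro span_minimal) auto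
  show "dim X \<le> dim (span (insert v Y))" using assms by (simp add: dim_insert_notin)
qed (use assms in auto)

text \<open>
  The sets \<open>X - Y\<close>, for \<open>X\<close> covering \<open>Y\<close>, partition \<open>Z - Y\<close>.
\<close>

lemma card_covers_above:
  assumes Y: "subspace Y" and Z: "subspace Z" and YZ: "Y \<subseteq> Z"
  shows "card {X. subspace X \<and> Y \<subseteq> X \<and> X \<subseteq> Z \<and> dim X = Suc (dim Y)} * (CARD('f) - 1)
      = CARD('f) ^ (dim Z - dim Y) - 1"
proof -
  let ?q = "CARD('f)" and ?C = "{X. subspace X \<and> Y \<subseteq> X \<and> X \<subseteq> Z \<and> dim X = Suc (dim Y)}"
  have le: "dim Y \<le> dim Z" using YZ by (rule dim_subset)
  have fin: "finite ?C" by (rule finite_subset[of _ UNIV]) (auto simp: Finite_Set.finite_set)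
  have "Z - Y = (\<Union>X\<in>?C. X - Y)"
  proof (intro equalityI subsetI)
    \<comment> \<open>The block of \<open>v\<close> belongs to \<open>span (insert v Y)\<close>, the
      only cover of \<open>Y\<close> containing \<open>v\<close>; this uniqueness also makes the
      blocks disjoint.\<close>
    fix v assume v: "v \<in> Z - Y"
    then have "span (insert v Y) \<in> ?C"
      using Y Z YZ span_minimal[of "insert v Y" Z] span_superset[of "insert v Y"]
      by (simp add: dim_insert_notin)
    moreover have "v \<in> span (insert v Y) - Y" using v by (simp add: span_base)
    ultimately show "v \<in> (\<Union>X\<in>?C. X - Y)" by blast
  qed auto
  then have "card (Z - Y) = (\<Sum>X\<in>?C. card (X - Y))"
  proof (simp only:, intro card_UN_disjoint fin ballI impI)
    fix X X' assume X: "X \<in> ?C" "X' \<in> ?C" "X \<noteq> X'"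
    show "(X - Y) \<inter> (X' - Y) = {}"
    proof (rule ccontr)
      assume "(X - Y) \<inter> (X' - Y) \<noteq> {}"
      then obtain v where "v \<in> X" "v \<in> X'" "v \<notin> Y" by blast
      then show False using X Y span_insert_eq[of X Y v] span_insert_eq[of X' Y v] by auto
    qed
  qed simp
  also have "\<dots> = (\<Sum>X\<in>?C. ?q ^ dim Y * (?q - 1))"
    using Y by (intro sum.cong refl) (auto simp: card_Diff_subset card_subspace algebra_simps)
  also have "card (Z - Y) = ?q ^ dim Y * (?q ^ (dim Z - dim Y) - 1)"
    using Y Z YZ le
    by (simp add: card_Diff_subset card_subspace diff_mult_distrib2 flip: power_add)
  finally show ?thesis using q_gt_1 by (simp add: mult.left_commute)
qed

text \<open>
  Double counting of the pairs of a hyperplane \<open>X \<supseteq> Y\<close> of \<open>Z\<close> and a vector in \<open>X - Y\<close>, where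
  the induction hypothesis counts the hyperplanes through a given vector.
\<close>

lemma card_covers_below:
  assumes "subspace Y" "subspace Z" "Y \<subseteq> Z"
  shows "card {X. subspace X \<and> Y \<subseteq> X \<and> X \<subseteq> Z \<and> Suc (dim X) = dim Z} * (CARD('f) - 1)
      = CARD('f) ^ (dim Z - dim Y) - 1"
  using assms
proof (induction "dim Z - dim Y" arbitrary: Y rule: less_induct)
  case (less Y)
  let ?q = "CARD('f)"
  let ?C = "\<lambda>Y. {X. subspace X \<and> Y \<subseteq> X \<and> X \<subseteq> Z \<and> Suc (dim X) = dim Z}"
  have le: "dim Y \<le> dim Z" using less.prems(3) by (rule dim_subset)
  have fin: "finite (?C Y)" for Y
    by (rule finite_subset[of _ UNIV]) (auto simp: Finite_Set.finite_set)
  define k where "k = dim Z - dim Y"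
  \<comment> \<open>The double counting ends by cancelling \<open>q^(k-1) - 1\<close>, which is
    nonzero only for \<open>k \<ge> 2\<close>; codimensions 0 and 1 are settled directly.\<close>
  consider "k = 0" | "k = 1" | "k \<ge> 2" by linarith
  then show ?case
  proof cases
    case 1
    then have "dim Y = dim Z" using le k_def by simp
    then have "?C Y = {}" by (auto dest!: dim_subset)
    then show ?thesis using 1 k_def by simp
  next
    case 2
    then have dY: "Suc (dim Y) = dim Z" using k_def by simp
    have "?C Y = {Y}"
    proof (intro equalityI subsetI)
      fix X assume "X \<in> ?C Y"
      then show "X \<in> {Y}" using dY less.prems subspace_dim_equal[of Y X] by auto
    qed (use dY less.prems in auto)
    then show ?thesis using 2 k_def by simp
  next
    case 3
    have dY: "dim Z = dim Y + k" using le k_def by simp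
    have cX: "card (X - Y) = ?q ^ dim Y * (?q ^ (k - 1) - 1)" if "X \<in> ?C Y" for X
    proof -
      have "dim X = dim Y + (k - 1)" using that dY 3 by auto
      then show ?thesis using that less.prems
        by (simp add: card_Diff_subset card_subspace power_add algebra_simps)
    qed
    have cv: "card {X \<in> ?C Y. v \<in> X} * (?q - 1) = ?q ^ (k - 1) - 1" if v: "v \<in> Z - Y" for v
    proof -
      let ?Y = "span (insert v Y)"
      \<comment> \<open>Hyperplanes through \<open>Y\<close> and \<open>v\<close> are those through
        \<open>span (insert v Y)\<close>, whose codimension in \<open>Z\<close> is smaller by
        one.\<close>
      have "?Y \<subseteq> X \<longleftrightarrow> v \<in> X \<and> Y \<subseteq> X" if "subspace X" for X
        using span_superset[of "insert v Y"] span_minimal[of "insert v Y" X] that by blast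
      then have "{X \<in> ?C Y. v \<in> X} = ?C ?Y" by blast
      moreover have "dim ?Y = Suc (dim Y)"
        using v less.prems by (simp add: dim_insert_notin)
      moreover have "?Y \<subseteq> Z" using v less.prems by (intro span_minimal) auto
      ultimately show ?thesis using less.hyps[of ?Y] less.prems(2) dY 3 by auto
    qed
    have "card (?C Y) * (?q - 1) * (?q ^ dim Y * (?q ^ (k - 1) - 1))
        = (\<Sum>X\<in>?C Y. card (X - Y)) * (?q - 1)"
      using cX by simp
    also have "(\<Sum>X\<in>?C Y. card (X - Y)) = (\<Sum>X\<in>?C Y. \<Sum>v\<in>Z-Y. if v \<in> X then 1 else 0)"
    proof (intro sum.cong refl)
      fix X assume "X \<in> ?C Y"
      then have "X - Y = {v \<in> Z - Y. v \<in> X}" by auto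
      then show "card (X - Y) = (\<Sum>v\<in>Z-Y. if v \<in> X then 1 else 0)"
        by (simp flip: sum.inter_filter)
    qed
    also have "\<dots> = (\<Sum>v\<in>Z-Y. \<Sum>X\<in>?C Y. if v \<in> X then 1 else 0)" by (rule sum.swap)
    also have "\<dots> = (\<Sum>v\<in>Z-Y. card {X \<in> ?C Y. v \<in> X})"
      using fin by (intro sum.cong refl) (simp flip: sum.inter_filter)
    also have "\<dots> * (?q - 1) = card (Z - Y) * (?q ^ (k - 1) - 1)"
      using cv by (simp add: sum_distrib_right)
    also have "card (Z - Y) = ?q ^ dim Y * (?q ^ k - 1)"
      using less.prems dY by (simp add: card_Diff_subset card_subspace power_add algebra_simps)
    finally have "(card (?C Y) * (?q - 1)) * (?q ^ dim Y * (?q ^ (k - 1) - 1))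
        = (?q ^ k - 1) * (?q ^ dim Y * (?q ^ (k - 1) - 1))"
      by (simp add: mult_ac)
    moreover have "?q ^ dim Y * (?q ^ (k - 1) - 1) \<noteq> 0"
      using one_less_power[OF q_gt_1, of "k - 1"] 3 by simp
    ultimately have "card (?C Y) * (?q - 1) = ?q ^ k - 1"
      using mult_right_cancel by blast
    then show ?thesis by (simp add: k_def)
  qed
qed

text \<open>
  Distinct subspaces \<open>Y\<close> and \<open>Z\<close> of the same dimension have at most one common cover, namely
  \<open>Y + Z\<close>, and at most one common lower cover, namely \<open>Y \<inter> Z\<close>; by the dimension formula
  one exists iff the other does.
\<close>

lemma common_covers:
  assumes Y: "subspace Y" and Z: "subspace Z" and ne: "Y \<noteq> Z"
  shows "card {X. subspace X \<and> Y \<subseteq> X \<and> Z \<subseteq> X \<and> dim X = Suc (dim Y) \<and> dim X = Suc (dim Z)}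
       = card {X. subspace X \<and> X \<subseteq> Y \<and> X \<subseteq> Z \<and> dim Y = Suc (dim X) \<and> dim Z = Suc (dim X)}"
    (is "card ?U = card ?L")
proof (cases "dim Y = dim Z")
  case False
  then show ?thesis by (auto intro: arg_cong[where f = card])
next
  case True
  let ?S = "{x + y |x y. x \<in> Y \<and> y \<in> Z}"
  have S: "subspace ?S" using Y Z by (rule subspace_sums)
  have I: "subspace (Y \<inter> Z)" using Y Z by (rule subspace_inter)
  have YS: "Y \<subseteq> ?S" "Z \<subseteq> ?S" using subspace_0[OF Y] subspace_0[OF Z] by force+
  have dims: "dim ?S + dim (Y \<inter> Z) = 2 * dim Y"
    using dim_sums_Int[OF Y Z] True by simp
  have "dim (Y \<inter> Z) \<noteq> dim Y"
    using subspace_dim_equal[of "Y \<inter> Z" Y] subspace_dim_equal[of "Y \<inter> Z" Z] I Y Z ne True by auto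
  then have less: "dim (Y \<inter> Z) < dim Y" using dim_subset[of "Y \<inter> Z" Y] by simp
  have U: "X = ?S" if "X \<in> ?U" for X
  proof -
    have "?S \<subseteq> X" using that by (auto intro: subspace_add)
    then show ?thesis
      using that subspace_dim_equal[of ?S X] S dims less by auto
  qed
  have L: "X = Y \<inter> Z" if "X \<in> ?L" for X
    using that subspace_dim_equal[of X "Y \<inter> Z"] I less by auto
  have singletonI_unique: "A = {a}" if "a \<in> A" "\<And>x. x \<in> A \<Longrightarrow> x = a" for A and a :: "'v set"
    using that by blast
  \<comment> \<open>By \<open>dims\<close>, \<open>Y + Z\<close> covers \<open>Y\<close> iff
    \<open>Y\<close> covers \<open>Y \<inter> Z\<close>. So either both sets are singletons or both
    are empty.\<close>
  show ?thesis
  proof (cases "dim Y = Suc (dim (Y \<inter> Z))")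
    case T: True
    have "dim ?S = Suc (dim Y)" using T dims by linarith
    then have "?S \<in> ?U" using S YS True by (simp only: mem_Collect_eq)
    then have "?U = {?S}" using U by (rule singletonI_unique)
    then have "card ?U = Suc 0" by (simp only:) simp
    moreover have "Y \<inter> Z \<in> ?L" using I T True by simp
    then have "?L = {Y \<inter> Z}" using L by (rule singletonI_unique)
    then have "card ?L = Suc 0" by (simp only:) simp
    ultimately show ?thesis by (simp only:)
  next
    case False
    have "?U = {}"
    proof (rule ccontr)
      assume "?U \<noteq> {}"
      then obtain X where X: "X \<in> ?U" by blast
      with U[OF X] have "?S \<in> ?U" by (simp only:)
      then have "dim ?S = Suc (dim Y)" by (simp only: mem_Collect_eq)
      then show False using dims less False by linarith
    qed
    moreover have "?L = {}"
    proof (rule ccontr)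
      assume "?L \<noteq> {}"
      then obtain X where X: "X \<in> ?L" by blast
      with L[OF X] have "Y \<inter> Z \<in> ?L" by (simp only:)
      then show False using False by simp
    qed
    ultimately show ?thesis by (simp only: card.empty)
  qed
qed

end

section \<open>Idempotents of the two families\<close>

text \<open>Each vector has unique components \<open>f v k\<close> in the eigenspaces, and
  \<open>f v i\<close> depends linearly on \<open>v\<close>. Any matrix with the two defining
  properties must act as this component map, so the description has exactly one solution.\<close>

lemma matrix_range_projection:
  fixes A :: "complex ^ 'x ^ 'x::finite" and t :: "nat \<Rightarrow> complex"
  assumes inj: "inj_on t {..N}" and span: "(\<Sum>k=0..N. eigenspace A (t k)) = UNIV" and i: "i \<le> N"
  shows "matrix_range (THE P. (\<forall>v\<in>eigenspace A (t i). P *v v = v) \<and>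
      (\<forall>j\<le>N. j \<noteq> i \<longrightarrow> (\<forall>v\<in>eigenspace A (t j). P *v v = 0))) = eigenspace A (t i)"
proof -
  let ?proj = "\<lambda>P. (\<forall>v\<in>eigenspace A (t i). P *v v = v) \<and>
      (\<forall>j\<le>N. j \<noteq> i \<longrightarrow> (\<forall>v\<in>eigenspace A (t j). P *v v = 0))"
  have "\<exists>f. (\<forall>k\<le>N. f k \<in> eigenspace A (t k)) \<and> v = (\<Sum>k\<le>N. f k)" for v
  proof -
    have "v \<in> (\<Sum>k=0..N. eigenspace A (t k))" using span by simp
    then obtain f where "\<And>k. k \<in> {0..N} \<Longrightarrow> f k \<in> eigenspace A (t k)" "v = (\<Sum>k=0..N. f k)"
      by (rule set_sumE) auto
    then show ?thesis by (intro exI[of _ f]) (auto simp: atLeast0AtMost)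
  qed
  then obtain f where f: "\<And>v k. k \<le> N \<Longrightarrow> f v k \<in> eigenspace A (t k)"
    and sum_f: "\<And>v. v = (\<Sum>k\<le>N. f v k)"
    by metis
  have unique: "g k = f v k"
    if g: "\<And>k. k \<le> N \<Longrightarrow> g k \<in> eigenspace A (t k)" "v = (\<Sum>k\<le>N. g k)" and k: "k \<le> N" for g v k
  proof -
    have "(\<Sum>k\<le>N. g k - f v k) = 0"
      using g(2) sum_f[of v] by (simp add: sum_subtractf)
    moreover have "g j - f v j \<in> eigenspace A (t j)" if "j \<in> {..N}" for j
      using that g(1) f by (intro vec.subspace_diff eigenspace_subspace) auto
    ultimately have "g k - f v k = 0"
      using eigenvectors_independent[of "{..N}" t "\<lambda>k. g k - f v k" A k] inj k by auto
    then show ?thesis by simp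
  qed
  have f_eig: "f v k = (if k = j then v else 0)" if "v \<in> eigenspace A (t j)" "j \<le> N" "k \<le> N" for v j k
    by (rule unique[symmetric, of "\<lambda>k. if k = j then v else 0"])
       (use that vec.subspace_0[OF eigenspace_subspace] in auto)
  have lin: "Vector_Spaces.linear (*s) (*s) (\<lambda>v. f v i)"
  proof
    show "f (v + w) i = f v i + f w i" for v w
    proof (rule unique[symmetric, OF _ _ i, of "\<lambda>k. f v k + f w k"])
      show "v + w = (\<Sum>k\<le>N. f v k + f w k)"
        using sum_f[of v] sum_f[of w] by (simp add: sum.distrib)
    qed (intro vec.subspace_add eigenspace_subspace f)
    show "f (c *s v) i = c *s f v i" for c v
    proof (rule unique[symmetric, OF _ _ i, of "\<lambda>k. c *s f v k"])
      show "c *s v = (\<Sum>k\<le>N. c *s f v k)"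
        using sum_f[of v] by (simp flip: vec.scale_sum_right)
    qed (intro vec.subspace_scale eigenspace_subspace f)
  qed
  have action: "P *v v = f v i" if "?proj P" for P v
  proof -
    have "P *v v = (\<Sum>k\<le>N. P *v f v k)"
      by (subst sum_f[of v]) (simp add: vec.linear_sum[OF matrix_vector_mul_linear_gen])
    also have "\<dots> = (\<Sum>k\<le>N. if k = i then f v i else 0)"
      using that f by (intro sum.cong) auto
    finally show ?thesis using i by simp
  qed
  have "?proj (matrix (\<lambda>v. f v i))"
    using f_eig i by (simp add: matrix_works[OF lin])
  then have "?proj (THE P. ?proj P)"
  proof (rule theI[where P = ?proj])
    show "P = matrix (\<lambda>v. f v i)" if "?proj P" for P
      unfolding matrix_eq by (simp add: action[OF that] matrix_works[OF lin])
  qed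
  note P = this action[OF this]
  show ?thesis
    unfolding matrix_range_def
  proof (intro equalityI subsetI)
    fix v assume "v \<in> range ((*v) (THE P. ?proj P))"
    then show "v \<in> eigenspace A (t i)" using P(2) f i by auto
  next
    fix v assume "v \<in> eigenspace A (t i)"
    then show "v \<in> range ((*v) (THE P. ?proj P))" 
      using P(1) by (intro range_eqI[of _ _ v]) simp
  qed
qed

text \<open>This turns sums of the \<open>E\<^sup>*\<^sub>jV\<close> into the support condition by
  which \<open>eigenspace_split\<close> describes its flag.\<close>

lemma sum_matrix_range_Estar:
  fixes sub :: "'x::finite \<Rightarrow> 'v::ab_group_add set"
    and smul :: "'f::{field,finite} \<Rightarrow> 'v \<Rightarrow> 'v"
  assumes "finite J"
  shows "(\<Sum>j\<in>J. matrix_range (Estar smul sub j)) = {v. \<forall>y. v $ y \<noteq> 0 \<longrightarrow> sdim smul sub y \<in> J}"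
proof -
  have E: "(Estar smul sub j *v v) $ y = (if sdim smul sub y = j then v $ y else 0)"
    for j y and v :: "complex ^ 'x"
    by (simp add: Estar_def matrix_vector_mult_def if_distrib[of "\<lambda>x. x * _"] if_distribR
        cong: if_cong)
  show ?thesis
  proof (intro equalityI subsetI)
    fix v assume "v \<in> (\<Sum>j\<in>J. matrix_range (Estar smul sub j))"
    then obtain f where f: "\<And>j. j \<in> J \<Longrightarrow> f j \<in> matrix_range (Estar smul sub j)" "v = (\<Sum>j\<in>J. f j)"
      by (rule set_sumE) (use assms in auto)
    have f0: "f j $ y = 0" if "j \<in> J" "sdim smul sub y \<notin> J" for j y
      using f(1)[OF that(1)] that by (auto simp: matrix_range_def E)
    have "v $ y = 0" if "sdim smul sub y \<notin> J" for y
      using f0 that by (simp add: f(2))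
    then show "v \<in> {v. \<forall>y. v $ y \<noteq> 0 \<longrightarrow> sdim smul sub y \<in> J}" by auto
  next
    fix v :: "complex ^ 'x"
    assume "v \<in> {v. \<forall>y. v $ y \<noteq> 0 \<longrightarrow> sdim smul sub y \<in> J}"
    then have "v = (\<Sum>j\<in>J. Estar smul sub j *v v)"
      using assms by (auto simp: vec_eq_iff E)
    then show "v \<in> (\<Sum>j\<in>J. matrix_range (Estar smul sub j))"
      using assms by (auto simp: mem_set_sum_iff matrix_range_def intro!: exI[of _ "\<lambda>j. Estar smul sub j *v v"])
  qed
qed

text \<open>As the index grows, \<open>\<phi> * q^(N-i)\<close> falls and \<open>q^i\<close> rises,
  so the values strictly decrease.\<close>

lemma theta_inj:
  assumes "1 < q" "\<phi> > 0"
  shows "inj_on (theta q N \<phi>) {..N}"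
proof (rule linorder_inj_onI)
  fix i j assume ij: "i < j" "j \<in> {..N}"
  have "real q ^ (N - j) < real q ^ (N - i)" "real q ^ i < real q ^ j"
    using assms ij by (auto intro!: power_strict_increasing)
  then have "\<phi> * real q ^ (N - j) - real q ^ j < \<phi> * real q ^ (N - i) - real q ^ i"
    using assms(2) by (smt (verit) mult_strict_left_mono)
  then show "theta q N \<phi> i \<noteq> theta q N \<phi> j"
    using assms(1) unfolding theta_def of_real_eq_iff by simp
qed auto

text \<open>\<open>matrix_inv\<close> is a choice among two-sided inverses, so evaluating it rests
  on their uniqueness.\<close>

lemma matrix_inv_unique:
  fixes A B :: "'a::semiring_1 ^ 'n::finite ^ 'n"
  assumes "A ** B = mat 1" "B ** A = mat 1"
  shows "matrix_inv A = B"
proof -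
  have "A ** matrix_inv A = mat 1 \<and> matrix_inv A ** A = mat 1"
    unfolding matrix_inv_def by (rule someI[of _ B]) (simp add: assms)
  then show ?thesis by (metis assms(2) matrix_mul_assoc matrix_mul_lid matrix_mul_rid)
qed

lemma matrix_inv_Astar:
  fixes smul :: "'f::{field,finite} \<Rightarrow> 'v::ab_group_add \<Rightarrow> 'v" and sub :: "'x::finite \<Rightarrow> 'v set"
  shows "matrix_inv (Astar smul sub) =
    (\<chi> y z. if y = z then of_nat CARD('f) ^ sdim smul sub y else 0)"
  by (rule matrix_inv_unique)
     (auto simp: Astar_def vec_eq_iff matrix_matrix_mult_def mat_def if_distrib[of "\<lambda>x. x * _"]
       sum.delta cong: if_cong)

section \<open>Relations between the matrices\<close>

text \<open>Making \<open>q\<close> a parameter tied to \<open>CARD('f)\<close> by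
  \<open>q_def\<close> keeps it a single complex symbol in the computations.\<close>

locale projective_geometry = finite_geometry scale Basis
  for scale :: "'f::{field,finite} \<Rightarrow> 'v::ab_group_add \<Rightarrow> 'v"
    and Basis :: "'v set" +
  fixes sub :: "'x::finite \<Rightarrow> 'v set" and q :: complex
  assumes q_def: "q = of_nat CARD('f)" and bij_sub: "bij_betw sub UNIV {W. subspace W}"
begin

abbreviation N :: nat where "N \<equiv> dim UNIV"
abbreviation sd :: "'x \<Rightarrow> nat" where "sd \<equiv> sdim scale sub"
abbreviation cov :: "'x \<Rightarrow> 'x \<Rightarrow> bool" where "cov \<equiv> covers scale sub"
abbreviation K :: "complex ^ 'x ^ 'x" where "K \<equiv> matrix_inv (Astar scale sub)"
abbreviation R :: "complex ^ 'x ^ 'x" where "R \<equiv> Rmat scale sub"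
abbreviation L :: "complex ^ 'x ^ 'x" where "L \<equiv> Lmat scale sub"

lemma q_neq: "q \<noteq> 0" "q - 1 \<noteq> 0"
  using q_gt_1 by (auto simp: q_def of_nat_eq_1_iff)

lemma sd_le: "sd y \<le> N"
  unfolding sdim_def by (rule dim_subset) simp

lemma subspace_sub: "subspace (sub y)"
  using bij_sub by (auto simp: bij_betw_def)

lemma sub_eq_iff: "sub y = sub z \<longleftrightarrow> y = z"
  using bij_sub by (auto simp: bij_betw_def inj_def)

text \<open>Moves counts over the index type to counts over subspaces, where the cover lemmas
  apply.\<close>

lemma card_labels: "card {x. P (sub x)} = card {X. subspace X \<and> P X}"
proof -
  have "sub ` {x. P (sub x)} = {X. subspace X \<and> P X}"
  proof (intro equalityI subsetI)
    fix X assume X: "X \<in> {X. subspace X \<and> P X}"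
    then have "X \<in> range sub" using bij_sub by (simp add: bij_betw_def)
    then show "X \<in> sub ` {x. P (sub x)}" using X by auto
  qed (auto simp: subspace_sub)
  moreover have "inj_on sub {x. P (sub x)}" by (simp add: inj_on_def sub_eq_iff)
  ultimately show ?thesis by (metis card_image)
qed

text \<open>The entries of \<open>LR\<close> and \<open>RL\<close> at \<open>(y, z)\<close> count
  common upper and common lower covers. Off the diagonal they agree by \<open>common_covers\<close>;
  on it, the counts times \<open>q - 1\<close> are \<open>q^(N - sd y) - 1\<close> and
  \<open>q^(sd y) - 1\<close>.\<close>

lemma LR_RL:
  "(q - 1) * (L *v (R *v v)) $ y = (q - 1) * (R *v (L *v v)) $ y + (q ^ (N - sd y) - q ^ sd y) * v $ y"
proof -
  let ?U = "\<lambda>y z. {x. cov x y \<and> cov x z}" and ?D = "\<lambda>y z. {x. cov y x \<and> cov z x}"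
  have prod: "(\<Sum>x\<in>UNIV. (if P x then 1 else 0) * (if Q x then 1 else 0)) = (of_nat (card {x. P x \<and> Q x}) :: complex)"
    for P Q :: "'x \<Rightarrow> bool"
  proof -
    have "(\<Sum>x\<in>UNIV. (if P x then 1 else 0) * (if Q x then 1 else 0)) = (\<Sum>x\<in>UNIV. if P x \<and> Q x then 1 else (0::complex))"
      by (intro sum.cong) auto
    then show ?thesis by (simp flip: sum.inter_filter)
  qed
  have LR: "(L *v (R *v v)) $ y = (\<Sum>z\<in>UNIV. of_nat (card (?U y z)) * v $ z)"
    by (simp add: matrix_vector_mul_assoc)
       (simp add: matrix_vector_mult_def matrix_matrix_mult_def Lmat_def Rmat_def prod)
  have RL: "(R *v (L *v v)) $ y = (\<Sum>z\<in>UNIV. of_nat (card (?D y z)) * v $ z)"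
    by (simp add: matrix_vector_mul_assoc)
       (simp add: matrix_vector_mult_def matrix_matrix_mult_def Lmat_def Rmat_def prod)
  have off: "card (?U y z) = card (?D y z)" if "z \<noteq> y" for z
  proof -
    have "card (?U y z) = card {X. subspace X \<and> (sub y \<subseteq> X \<and> sub z \<subseteq> X \<and>
        dim X = Suc (dim (sub y)) \<and> dim X = Suc (dim (sub z)))}"
      unfolding card_labels[symmetric] by (rule arg_cong[where f = card]) (auto simp: covers_def sdim_def)
    also have "\<dots> = card {X. subspace X \<and> (X \<subseteq> sub y \<and> X \<subseteq> sub z \<and>
        dim (sub y) = Suc (dim X) \<and> dim (sub z) = Suc (dim X))}"
      using that by (intro common_covers subspace_sub) (simp add: sub_eq_iff)
    also have "\<dots> = card (?D y z)"
      unfolding card_labels[symmetric] by (rule arg_cong[where f = card]) (auto simp: covers_def sdim_def)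
    finally show ?thesis .
  qed
  have up: "card (?U y y) * (CARD('f) - 1) = CARD('f) ^ (N - sd y) - 1"
  proof -
    have "card (?U y y) = card {X. subspace X \<and> (sub y \<subseteq> X \<and> X \<subseteq> UNIV \<and> dim X = Suc (dim (sub y)))}"
      unfolding card_labels[symmetric] by (rule arg_cong[where f = card]) (auto simp: covers_def sdim_def)
    then show ?thesis
      using card_covers_above[OF subspace_sub[of y] subspace_UNIV] by (simp add: sdim_def)
  qed
  have down: "card (?D y y) * (CARD('f) - 1) = CARD('f) ^ sd y - 1"
  proof -
    \<comment> \<open>\<open>{0}\<close> lies in every subspace, so the count of hyperplanes above a
      given subspace specializes to all hyperplanes of \<open>sub y\<close>.\<close>
    have "card (?D y y) = card {X. subspace X \<and> ({0} \<subseteq> X \<and> X \<subseteq> sub y \<and> Suc (dim X) = dim (sub y))}"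
      unfolding card_labels[symmetric] using subspace_0[OF subspace_sub]
      by (intro arg_cong[where f = card]) (auto simp: covers_def sdim_def)
    then show ?thesis
      using card_covers_below[OF subspace_single_0 subspace_sub[of y]] subspace_0[OF subspace_sub]
      by (simp add: sdim_def)
  qed
  have cnat: "of_nat (CARD('f) ^ n - 1) = q ^ n - 1" "of_nat (CARD('f) - 1) = q - 1" for n
    using q_gt_1 by (simp_all add: q_def of_nat_diff)
  have "of_nat (card (?U y y)) * (q - 1) = q ^ (N - sd y) - 1"
       "of_nat (card (?D y y)) * (q - 1) = q ^ sd y - 1"
    using up down cnat by (metis of_nat_mult)+
  moreover have "(q - 1) * (a * t) = (q - 1) * (b * t) + (c - d) * t"
    if "a * (q - 1) = c - 1" "b * (q - 1) = d - 1" for a b c d t :: complex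
    using that by algebra
  ultimately have "(q - 1) * (of_nat (card (?U y y)) * v $ y)
      = (q - 1) * (of_nat (card (?D y y)) * v $ y) + (q ^ (N - sd y) - q ^ sd y) * v $ y"
    by blast
  then show ?thesis
    unfolding LR RL by (simp add: sum.remove[of UNIV y] off algebra_simps)
qed

lemma K_component: "(K *v v) $ y = q ^ sd y * v $ y"
  by (simp add: matrix_inv_Astar matrix_vector_mult_def q_def if_distrib[of "\<lambda>x. x * _"] cong: if_cong)

text \<open>\<open>K\<close> scales the coordinate at \<open>y\<close> by \<open>q^(sd y)\<close>,
  and a nonzero entry of \<open>R\<close> raises the dimension by one. \<open>LK\<close> is the same
  for \<open>L\<close>.\<close>

lemma KR: "K *v (R *v v) = q *s (R *v (K *v v))"
proof -
  have "q ^ sd y * (\<Sum>z\<in>UNIV. R $ y $ z * v $ z) = q * (\<Sum>z\<in>UNIV. R $ y $ z * (q ^ sd z * v $ z))" for y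
    unfolding sum_distrib_left by (intro sum.cong) (auto simp: Rmat_def covers_def)
  then show ?thesis
    by (simp add: vec_eq_iff K_component matrix_vector_mult_def[of R])
qed

lemma LK: "L *v (K *v v) = q *s (K *v (L *v v))"
proof -
  have "(\<Sum>z\<in>UNIV. L $ y $ z * (q ^ sd z * v $ z)) = q * (q ^ sd y * (\<Sum>z\<in>UNIV. L $ y $ z * v $ z))" for y
    unfolding sum_distrib_left by (intro sum.cong) (auto simp: Lmat_def covers_def)
  then show ?thesis
    by (simp add: vec_eq_iff K_component matrix_vector_mult_def[of L])
qed

text \<open>Multiplying \<open>LR_RL\<close> by \<open>K\<close> turns the power
  \<open>q^(N - sd y)\<close>, which depends on \<open>y\<close>, into the scalar
  \<open>q^N\<close>.\<close>

lemma KLR: "(q - 1) *s (K *v (L *v (R *v v))) = (q - 1) *s (K *v (R *v (L *v v))) + (q ^ N) *s v - K *v (K *v v)"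
proof -
  have "q ^ sd y * q ^ (N - sd y) = q ^ N" for y
    using sd_le[of y] by (simp flip: power_add)
  moreover have "(q - 1) * (c * l) = (q - 1) * (c * r) + n * x - c * (c * x)"
    if "c * d = n" "(q - 1) * l = (q - 1) * r + (d - c) * x" for c d n l r x :: complex
    using arg_cong[OF that(2), of "(*) c"] by (simp add: algebra_simps flip: that(1))
  ultimately have "(q - 1) * (q ^ sd y * (L *v (R *v v)) $ y)
     = (q - 1) * (q ^ sd y * (R *v (L *v v)) $ y) + q ^ N * v $ y - q ^ sd y * (q ^ sd y * v $ y)" for y
    using LR_RL by blast
  then show ?thesis
    by (simp only: vec_eq_iff K_component vector_add_component vector_minus_component
        vector_smult_component) simp
qed

text \<open>
  The matrices \<open>lowering_mat s\<close> and \<open>raising_mat s\<close> are,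
  respectively, \<open>A\<^sup>-\<close> and \<open>A\<^sup>+\<close> for \<open>s = 1\<close>, and \<open>A\<^sub>-\<close> and \<open>A\<^sub>+\<close> for \<open>s = - \<phi>\<close>.
\<close>

definition lowering_mat :: "complex \<Rightarrow> complex ^ 'x ^ 'x" where
  "lowering_mat s = (\<chi> y z. (if y = z then q ^ sd y / (q - 1) else 0) + s * q ^ sd y * L $ y $ z)"

definition raising_mat :: "complex \<Rightarrow> complex ^ 'x ^ 'x" where
  "raising_mat s = (\<chi> y z. (if y = z then q ^ sd y / (q - 1) else 0) - inverse s * R $ y $ z)"

lemma lowering_mat_mult: "lowering_mat s *v v = inverse (q - 1) *s (K *v v) + s *s (K *v (L *v v))"
proof -
  have "(\<Sum>z\<in>UNIV. ((if y = z then q ^ sd y / (q - 1) else 0) + s * q ^ sd y * L $ y $ z) * v $ z)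
      = inverse (q - 1) * (q ^ sd y * v $ y) + s * (q ^ sd y * (\<Sum>z\<in>UNIV. L $ y $ z * v $ z))" for y
    unfolding distrib_right sum.distrib sum_distrib_left
    by (simp add: if_distrib[of "\<lambda>x. _ * x"] divide_inverse mult_ac cong: if_cong)
  then show ?thesis
    by (simp add: vec_eq_iff K_component matrix_vector_mult_def[of L] matrix_vector_mult_def[of "lowering_mat s"])
       (simp add: lowering_mat_def)
qed

lemma raising_mat_mult: "raising_mat s *v v = inverse (q - 1) *s (K *v v) - inverse s *s (R *v v)"
proof -
  have "(\<Sum>z\<in>UNIV. ((if y = z then q ^ sd y / (q - 1) else 0) - inverse s * R $ y $ z) * v $ z)
      = inverse (q - 1) * (q ^ sd y * v $ y) - inverse s * (\<Sum>z\<in>UNIV. R $ y $ z * v $ z)" for y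
    unfolding left_diff_distrib sum_subtractf sum_distrib_left
    by (simp add: if_distrib[of "\<lambda>x. _ * x"] divide_inverse mult_ac cong: if_cong)
  then show ?thesis
    by (simp add: vec_eq_iff K_component matrix_vector_mult_def[of R] matrix_vector_mult_def[of "raising_mat s"])
       (simp add: raising_mat_def)
qed

text \<open>On expanding, the mixed terms \<open>K R\<close> and \<open>K L K\<close> cancel by
  \<open>KR\<close> and \<open>LK\<close>. What remains is \<open>K L R - K R L\<close> plus a
  multiple of \<open>K K\<close>, and by \<open>KLR\<close> the \<open>K K\<close> parts cancel
  too.\<close>

lemma q_commutator:
  assumes "s \<noteq> 0"
  shows "q *s (raising_mat s *v (lowering_mat s *v v)) - lowering_mat s *v (raising_mat s *v v) = (q ^ N / (q - 1)) *s v"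
proof -
  define kk where "kk = inverse (q - 1)"
  have RKL: "q *s (R *v (K *v (L *v v))) = K *v (R *v (L *v v))"
    by (simp add: KR)
  have kk: "(q - 1) * kk = 1" using q_neq by (simp add: kk_def)
  have s: "inverse s * s = 1" using assms by simp
  have "(q * (raising_mat s *v (lowering_mat s *v v)) $ y - (lowering_mat s *v (raising_mat s *v v)) $ y) = (q ^ N * kk) * v $ y" for y
  proof -
    have E: "(q - 1) * (K *v (L *v (R *v v))) $ y
        = (q - 1) * (K *v (R *v (L *v v))) $ y + q ^ N * v $ y - (K *v (K *v v)) $ y"
      using arg_cong[OF KLR, of "\<lambda>w. w $ y"]
      by (simp only: vector_add_component vector_minus_component vector_smult_component)
    have E2: "q * (R *v (K *v (L *v v))) $ y = (K *v (R *v (L *v v))) $ y"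
      using RKL by (simp add: vec_eq_iff)
    have E3: "q * (R *v (K *v v)) $ y = (K *v (R *v v)) $ y"
      using KR[of v] by (simp add: vec_eq_iff)
    have E4: "(K *v (L *v (K *v v))) $ y = q * (K *v (K *v (L *v v))) $ y"
      by (simp add: LK vector_scalar_commute)
    have "(raising_mat s *v (lowering_mat s *v v)) $ y = kk * (kk * (K *v (K *v v)) $ y + s * (K *v (K *v (L *v v))) $ y)
        - inverse s * (kk * (R *v (K *v v)) $ y + s * (R *v (K *v (L *v v))) $ y)"
      by (simp add: raising_mat_mult lowering_mat_mult matrix_vector_right_distrib vector_scalar_commute kk_def algebra_simps)
    moreover have "(lowering_mat s *v (raising_mat s *v v)) $ y
        = kk * (kk * (K *v (K *v v)) $ y - inverse s * (K *v (R *v v)) $ y)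
        + s * (kk * (K *v (L *v (K *v v))) $ y - inverse s * (K *v (L *v (R *v v))) $ y)"
      by (simp add: raising_mat_mult lowering_mat_mult matrix_vector_mult_diff_distrib vector_scalar_commute kk_def algebra_simps)
    \<comment> \<open>A scalar identity for the coordinates at \<open>y\<close>: \<open>a\<close> to
      \<open>h\<close> stand for those of \<open>KKv\<close>, \<open>KKLv\<close>,
      \<open>RKv\<close>, \<open>RKLv\<close>, \<open>KRv\<close>, \<open>KLKv\<close>,
      \<open>KLRv\<close>, \<open>KRLv\<close>, while \<open>k = 1/(q-1)\<close>,
      \<open>t = 1/s\<close>, \<open>n = q^N\<close> and \<open>x\<close> is that of
      \<open>v\<close>.\<close>
    moreover have "q * (k * (k * a + s * b) - t * (k * c + s * d))
        - (k * (k * a - t * e) + s * (k * f - t * g)) = n * k * x"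
      if "q * c = e" "q * d = h" "f = q * b" "(q - 1) * g = (q - 1) * h + n * x - a"
        "(q - 1) * k = 1" "t * s = 1"
      for a b c d e f g h k n t x :: complex
    proof -
      have "g = h + k * (n * x) - k * a" using that(4,5) by algebra
      moreover have "q * (k * (k * a)) = k * a + k * (k * a)" using that(5) by algebra
      ultimately show ?thesis
        unfolding that(1)[symmetric] that(3) using that(2,6) by (simp add: algebra_simps)
    qed
    note this[OF E3 E2 E4 E kk s]
    ultimately show ?thesis by (simp only:)
  qed
  then show ?thesis by (simp add: vec_eq_iff kk_def divide_inverse)
qed

text \<open>Write \<open>M\<close>, \<open>P\<close> for the lowering and raising matrices. If
  \<open>M v = \<kappa> v\<close>, then \<open>q_commutator\<close> gives
  \<open>(M - q \<kappa>) P v = - q^N / (q-1) v\<close>. Hence \<open>P v\<close> differs by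
  \<open>q^(N-k) / (q-1) v\<close> from a vector of the eigenspace for \<open>q \<kappa>\<close>,
  and \<open>A = a M - b P\<close>.\<close>

lemma lowering_mat_eigenspace_shift:
  assumes s: "s \<noteq> 0" and A: "\<And>v. A *v v = a *s (lowering_mat s *v v) - b *s (raising_mat s *v v)"
    and k: "k \<le> N" and v: "v \<in> eigenspace (lowering_mat s) (q ^ k / (q - 1))"
  shows "A *v v - ((a * q ^ k - b * q ^ (N - k)) / (q - 1)) *s v
    \<in> eigenspace (lowering_mat s) (q ^ Suc k / (q - 1))"
proof -
  define \<kappa> where "\<kappa> = q ^ k / (q - 1)"
  define c where "c = (a * q ^ k - b * q ^ (N - k)) / (q - 1)"
  have Q: "q ^ k * q ^ (N - k) = q ^ N" using k by (simp flip: power_add)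
  have q\<kappa>: "q * \<kappa> = q ^ k + \<kappa>" using q_neq by (simp add: \<kappa>_def field_simps)
  have Mv: "lowering_mat s *v v = \<kappa> *s v"
    using v by (simp add: eigenspace_def \<kappa>_def)
  have "(lowering_mat s *v (A *v v - c *s v)) $ y = q * \<kappa> * (A *v v - c *s v) $ y" for y
  proof -
    define p mp t where "p = (raising_mat s *v v) $ y" and "mp = (lowering_mat s *v (raising_mat s *v v)) $ y" and "t = v $ y"
    have rel: "q * (\<kappa> * p) - mp = q ^ N / (q - 1) * t"
      using arg_cong[OF q_commutator[OF s, of v], of "\<lambda>w. w $ y"]
      by (simp add: Mv vector_scalar_commute p_def mp_def t_def mult.assoc)
    have "q * (\<kappa> * p) = (q ^ k + \<kappa>) * p" by (simp flip: q\<kappa>)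
    with rel have mp: "mp = (q ^ k + \<kappa>) * p - q ^ N / (q - 1) * t" by (simp add: algebra_simps)
    have "(lowering_mat s *v (A *v v - c *s v)) $ y = a * (\<kappa> * (\<kappa> * t)) - b * mp - c * (\<kappa> * t)"
      by (simp add: A Mv matrix_vector_mult_diff_distrib vector_scalar_commute mp_def t_def)
    also have "\<dots> = q * \<kappa> * (a * (\<kappa> * t) - b * p - c * t)"
      unfolding mp q\<kappa> c_def unfolding \<kappa>_def Q[symmetric]
      by (simp add: algebra_simps divide_inverse)
    also have "a * (\<kappa> * t) - b * p - c * t = (A *v v - c *s v) $ y"
      by (simp add: A Mv p_def t_def)
    finally show ?thesis .
  qed
  then have "lowering_mat s *v (A *v v - c *s v) = (q * \<kappa>) *s (A *v v - c *s v)"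
    by (simp only: vec_eq_iff vector_smult_component) simp
  then show ?thesis by (simp add: eigenspace_def c_def \<kappa>_def)
qed

text \<open>The mirror image: \<open>M v\<close> differs by \<open>q^k / (q-1) v\<close> from a
  vector of the eigenspace of \<open>P\<close> for \<open>\<kappa> / q\<close>. The eigenvalue is
  written with \<open>q^N / q^k\<close> because \<open>N - Suc k\<close> would truncate at
  \<open>k = N\<close> and repeat the previous value.\<close>

lemma raising_mat_eigenspace_shift:
  assumes s: "s \<noteq> 0" and A: "\<And>v. A *v v = a *s (lowering_mat s *v v) - b *s (raising_mat s *v v)"
    and k: "k \<le> N" and v: "v \<in> eigenspace (raising_mat s) (q ^ N / q ^ k / (q - 1))"
  shows "A *v v - ((a * q ^ k - b * q ^ (N - k)) / (q - 1)) *s v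
    \<in> eigenspace (raising_mat s) (q ^ N / q ^ Suc k / (q - 1))"
proof -
  define \<kappa> where "\<kappa> = q ^ (N - k) / (q - 1)"
  define c where "c = (a * q ^ k - b * q ^ (N - k)) / (q - 1)"
  have Q: "q ^ k * q ^ (N - k) = q ^ N" using k by (simp flip: power_add)
  then have Q': "q ^ N / q ^ k = q ^ (N - k)" using q_neq by (simp add: field_simps)
  have q\<kappa>: "q * \<kappa> = q ^ (N - k) + \<kappa>" using q_neq by (simp add: \<kappa>_def field_simps)
  have Pv: "raising_mat s *v v = \<kappa> *s v"
    using v unfolding Q' by (simp add: eigenspace_def \<kappa>_def)
  have "q * (raising_mat s *v (A *v v - c *s v)) $ y = \<kappa> * (A *v v - c *s v) $ y" for y
  proof -
    define m pm t where "m = (lowering_mat s *v v) $ y" and "pm = (raising_mat s *v (lowering_mat s *v v)) $ y" and "t = v $ y"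
    have rel: "q * pm - \<kappa> * m = q ^ N / (q - 1) * t"
      using arg_cong[OF q_commutator[OF s, of v], of "\<lambda>w. w $ y"]
      by (simp add: Pv vector_scalar_commute m_def pm_def t_def)
    then have pm: "q * pm = \<kappa> * m + q ^ N / (q - 1) * t" by (simp add: algebra_simps)
    have "q * (raising_mat s *v (A *v v - c *s v)) $ y = q * (a * pm - b * (\<kappa> * (\<kappa> * t)) - c * (\<kappa> * t))"
      by (simp add: A Pv matrix_vector_mult_diff_distrib vector_scalar_commute pm_def t_def)
    also have "\<dots> = a * (q * pm) - b * ((q * \<kappa>) * (\<kappa> * t)) - c * ((q * \<kappa>) * t)"
      by (simp add: algebra_simps)
    also have "\<dots> = \<kappa> * (a * m - b * (\<kappa> * t) - c * t)"
      unfolding pm q\<kappa> c_def unfolding \<kappa>_def Q[symmetric]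
      by (simp add: algebra_simps divide_inverse)
    also have "a * m - b * (\<kappa> * t) - c * t = (A *v v - c *s v) $ y"
      by (simp add: A Pv m_def t_def)
    finally show ?thesis .
  qed
  then have "(raising_mat s *v (A *v v - c *s v)) $ y = \<kappa> / q * (A *v v - c *s v) $ y" for y
    using q_neq(1) by (metis nonzero_mult_div_cancel_left times_divide_eq_left)
  then have "raising_mat s *v (A *v v - c *s v) = (\<kappa> / q) *s (A *v v - c *s v)"
    by (simp only: vec_eq_iff vector_smult_component) simp
  moreover have "\<kappa> / q = q ^ N / q ^ Suc k / (q - 1)"
    unfolding \<kappa>_def Q'[symmetric] by simp
  ultimately show ?thesis by (simp add: eigenspace_def c_def)
qed

lemma power_q_inj: "q ^ j = q ^ k \<longleftrightarrow> j = k"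
  using power_inject_exp[OF q_gt_1, of j k] unfolding q_def by (metis of_nat_eq_iff of_nat_power)

section \<open>Splittings for a combination \<open>a M - b P\<close> of the lowering and raising
  matrices\<close>

context
  fixes A :: "complex ^ 'x ^ 'x" and a b s :: complex and \<tau> :: "nat \<Rightarrow> complex"
  assumes s: "s \<noteq> 0" and A: "\<And>v. A *v v = a *s (lowering_mat s *v v) - b *s (raising_mat s *v v)"
    and \<tau>: "\<And>k. k \<le> N \<Longrightarrow> \<tau> k = (a * q ^ k - b * q ^ (N - k)) / (q - 1)"
    and inj: "inj_on \<tau> {..N}"
begin

text \<open>A nonzero off-diagonal entry at \<open>(y, z)\<close> needs \<open>z\<close> to cover
  \<open>y\<close>, so \<open>eigenspace_split\<close> applies with level \<open>sd\<close>.\<close>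

lemma lowering_mat_split:
  shows "(\<Sum>k=0..N. eigenspace A (\<tau> k)) = UNIV"
    and "i \<le> N \<Longrightarrow> eigenspace (lowering_mat s) (q ^ i / (q - 1)) =
      {v. \<forall>y. v $ y \<noteq> 0 \<longrightarrow> sd y \<le> i} \<inter> (\<Sum>k=i..N. eigenspace A (\<tau> k))"
proof -
  have diag: "lowering_mat s $ y $ y = q ^ sd y / (q - 1)" for y
    by (simp add: lowering_mat_def Lmat_def covers_def)
  have tri: "sd y < sd z" if "y \<noteq> z" "lowering_mat s $ y $ z \<noteq> 0" for y z
    using that by (auto simp: lowering_mat_def Lmat_def covers_def split: if_splits)
  have shift: "A *v v - \<tau> k *s v \<in> eigenspace (lowering_mat s) (q ^ Suc k / (q - 1))"
    if "k \<le> N" "v \<in> eigenspace (lowering_mat s) (q ^ k / (q - 1))" for k v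
    using lowering_mat_eigenspace_shift[OF s A that] \<tau>[OF that(1)] by simp
  have inj': "inj_on (\<lambda>k. q ^ k / (q - 1)) {..Suc N}"
    using q_neq by (intro inj_onI) (simp add: power_q_inj)
  note split = eigenspace_split[where l = sd and \<nu> = "\<lambda>k. q ^ k / (q - 1)" and \<tau> = \<tau>,
      OF sd_le diag tri shift inj' inj]
  show "(\<Sum>k=0..N. eigenspace A (\<tau> k)) = UNIV"
    by (rule split(1)) simp_all
  show "eigenspace (lowering_mat s) (q ^ i / (q - 1)) =
      {v. \<forall>y. v $ y \<noteq> 0 \<longrightarrow> sd y \<le> i} \<inter> (\<Sum>k=i..N. eigenspace A (\<tau> k))" if "i \<le> N"
    by (rule split(2)) (use that in simp_all)
qed

text \<open>\<open>R\<close> leads up in dimension, so triangularity holds for the level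
  \<open>N - sd y\<close>. The eigenvalues then run downwards, and \<open>q^i / (q-1)\<close> has
  index \<open>N - i\<close>.\<close>

lemma raising_mat_split:
  assumes "i \<le> N"
  shows "eigenspace (raising_mat s) (q ^ i / (q - 1)) =
      {v. \<forall>y. v $ y \<noteq> 0 \<longrightarrow> i \<le> sd y} \<inter> (\<Sum>k=N-i..N. eigenspace A (\<tau> k))"
proof -
  have pow: "q ^ N / q ^ (N - k) = q ^ k" if "k \<le> N" for k
    using that q_neq by (simp add: power_diff)
  have diag: "raising_mat s $ y $ y = q ^ N / q ^ (N - sd y) / (q - 1)" for y
    using pow[OF sd_le[of y]] by (simp add: raising_mat_def Rmat_def covers_def)
  have tri: "N - sd y < N - sd z" if "y \<noteq> z" "raising_mat s $ y $ z \<noteq> 0" for y z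
    using that sd_le[of y] sd_le[of z] by (auto simp: raising_mat_def Rmat_def covers_def split: if_splits)
  have shift: "A *v v - \<tau> k *s v \<in> eigenspace (raising_mat s) (q ^ N / q ^ Suc k / (q - 1))"
    if "k \<le> N" "v \<in> eigenspace (raising_mat s) (q ^ N / q ^ k / (q - 1))" for k v
    using raising_mat_eigenspace_shift[OF s A that] \<tau>[OF that(1)] by simp
  have inj': "inj_on (\<lambda>k. q ^ N / q ^ k / (q - 1)) {..Suc N}"
    using q_neq by (intro inj_onI) (simp add: power_q_inj divide_inverse)
  have le: "N - sd y \<le> N" for y by simp
  have "eigenspace (raising_mat s) (q ^ N / q ^ (N - i) / (q - 1)) =
      {v. \<forall>y. v $ y \<noteq> 0 \<longrightarrow> N - sd y \<le> N - i} \<inter> (\<Sum>k=N-i..N. eigenspace A (\<tau> k))"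
    by (rule eigenspace_split(2)[where l = "\<lambda>y. N - sd y" and \<nu> = "\<lambda>k. q ^ N / q ^ k / (q - 1)"
          and \<tau> = \<tau>, OF le diag tri shift inj' inj]) simp_all
  moreover have "N - sd y \<le> N - i \<longleftrightarrow> i \<le> sd y" for y
    using assms sd_le[of y] by linarith
  ultimately show ?thesis unfolding pow[OF assms] by simp
qed

end

section \<open>The four matrices and \<open>A\<close> in terms of the lowering and raising
  matrices\<close>

lemma K_matrix_mult: "(K ** M) $ y $ z = q ^ sd y * M $ y $ z"
  by (simp add: matrix_inv_Astar matrix_matrix_mult_def q_def if_distrib[of "\<lambda>x. x * _"] cong: if_cong)

lemma K_entry: "K $ y $ z = (if y = z then q ^ sd y else 0)"
  by (simp add: matrix_inv_Astar q_def)

lemma A_upper_minus_eq: "A_upper_minus scale sub = lowering_mat 1"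
  unfolding A_upper_minus_def
  by (auto simp: vec_eq_iff lowering_mat_def K_matrix_mult K_entry scaleR_conv_of_real[where 'a = complex] q_def[symmetric])

lemma A_upper_plus_eq: "A_upper_plus scale sub = raising_mat 1"
  unfolding A_upper_plus_def
  by (auto simp: vec_eq_iff raising_mat_def K_entry scaleR_conv_of_real[where 'a = complex] q_def[symmetric])

lemma A_lower_minus_eq: "A_lower_minus scale sub \<phi> = lowering_mat (- of_real \<phi>)"
  unfolding A_lower_minus_def
  by (auto simp: vec_eq_iff lowering_mat_def K_matrix_mult K_entry scaleR_conv_of_real[where 'a = complex] q_def[symmetric])

lemma A_lower_plus_eq: "A_lower_plus scale sub \<phi> = raising_mat (- of_real \<phi>)"
  unfolding A_lower_plus_def
  by (auto simp: vec_eq_iff raising_mat_def K_entry scaleR_conv_of_real[where 'a = complex] q_def[symmetric])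

lemma Amat_mult:
  "Amat scale sub \<phi> *v v
    = R *v v + of_real \<phi> *s (K *v (L *v v)) + ((of_real \<phi> - 1) / (q - 1)) *s (K *v v)"
proof -
  have "(c *\<^sub>R M) *v v = of_real c *s (M *v v)" for c and M :: "complex ^ 'x ^ 'x"
    by (simp add: vec_eq_iff matrix_vector_mult_def scaleR_conv_of_real[where 'a = complex] sum_distrib_left mult.assoc)
  then show ?thesis
    by (simp add: Amat_def matrix_vector_mult_add_rdistrib matrix_vector_mul_assoc q_def)
qed

text \<open>The factor \<open>1 *s\<close> keeps the pattern \<open>a M - b P\<close> of the
  splitting lemmas, here with \<open>a = \<phi>\<close> and \<open>b = 1\<close>.\<close>

lemma Amat_upper: "Amat scale sub \<phi> *v v = of_real \<phi> *s (lowering_mat 1 *v v) - 1 *s (raising_mat 1 *v v)"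
  by (simp add: Amat_mult lowering_mat_mult raising_mat_mult vec_eq_iff divide_inverse algebra_simps)

lemma Amat_lower:
  assumes "\<phi> \<noteq> 0"
  shows "Amat scale sub \<phi> *v v = (- 1) *s (lowering_mat (- of_real \<phi>) *v v) - (- of_real \<phi>) *s (raising_mat (- of_real \<phi>) *v v)"
proof -
  have "complex_of_real \<phi> * (inverse (complex_of_real \<phi>) * x) = x" for x
    using assms by simp
  then show ?thesis
    by (simp add: Amat_mult lowering_mat_mult raising_mat_mult vec_eq_iff divide_inverse algebra_simps)
qed

lemma theta_eq: "theta CARD('f) N \<phi> k = (of_real \<phi> * q ^ (N - k) - q ^ k) / (q - 1)"
  by (simp add: theta_def q_def)

end

theorem theorem15p21:
  fixes smul :: "'f::{field,finite} \<Rightarrow> 'v::ab_group_add \<Rightarrow> 'v"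
    and sub :: "'x::finite \<Rightarrow> 'v set"
    and N i :: nat
    and \<phi> :: real
  assumes "vector_space smul"
    and "N \<ge> 1"
    and "vector_space.dim smul UNIV = N"
    and "bij_betw sub UNIV {W. module.subspace smul W}"
    and "\<phi> > 0"
    and "i \<le> N"
  shows "U_dd smul sub i =
           (\<Sum>j = 0..i. matrix_range (Estar smul sub j)) \<inter>
           (\<Sum>j = 0..N - i. matrix_range (Emat smul sub N \<phi> j)) \<and>
         U_ud smul sub i =
           (\<Sum>j = i..N. matrix_range (Estar smul sub j)) \<inter>
           (\<Sum>j = 0..i. matrix_range (Emat smul sub N \<phi> j)) \<and>
         U_du smul sub \<phi> i =
           (\<Sum>j = 0..i. matrix_range (Estar smul sub j)) \<inter>
           (\<Sum>j = i..N. matrix_range (Emat smul sub N \<phi> j)) \<and>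
         U_uu smul sub \<phi> i =
           (\<Sum>j = i..N. matrix_range (Estar smul sub j)) \<inter>
           (\<Sum>j = N - i..N. matrix_range (Emat smul sub N \<phi> j))"
proof -
  interpret V: vector_space smul by fact
  obtain B where B: "V.independent B" "UNIV \<subseteq> V.span B" "card B = N"
    using V.basis_exists[of UNIV] assms(3) by metis
  \<comment> \<open>An infinite basis would have cardinality 0, contradicting
    \<open>N \<ge> 1\<close>.\<close>
  then have "finite B" using assms(2) by (metis card.infinite not_one_le_zero)
  with B interpret finite_dimensional_vector_space smul B
    by unfold_locales auto
  interpret projective_geometry smul B sub "of_nat CARD('f)"
    by unfold_locales (use assms(4) in auto)
  let ?q = "of_nat CARD('f) :: complex" and ?A = "Amat smul sub \<phi>" and ?\<theta> = "theta CARD('f) N \<phi>"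
  have th: "?\<theta> k = (of_real \<phi> * ?q ^ (N - k) - ?q ^ k) / (?q - 1)" for k
    using theta_eq[of \<phi> k] by (simp only: assms(3))
  have inj: "inj_on ?\<theta> {..N}" using q_gt_1 assms(5) by (rule theta_inj)
  then have inj': "inj_on (\<lambda>k. ?\<theta> (N - k)) {..N}"
    by (intro inj_onI) (force dest: inj_onD)
  \<comment> \<open>Parameters \<open>s = 1\<close>, \<open>a = \<phi>\<close>,
    \<open>b = 1\<close>: the eigenvalues of \<open>A\<close> are met in reverse order,
    \<open>\<tau> k = \<theta>\<close> at \<open>N - k\<close>.\<close>
  have upper: "1 \<noteq> (0::complex)" "?A *v v = of_real \<phi> *s (lowering_mat 1 *v v) - 1 *s (raising_mat 1 *v v)"
    "k \<le> N \<Longrightarrow> ?\<theta> (N - k) = (of_real \<phi> * ?q ^ k - 1 * ?q ^ (N - k)) / (?q - 1)" for v k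
    by (auto simp: Amat_upper th)
  \<comment> \<open>Parameters \<open>s = - \<phi>\<close>, \<open>a = - 1\<close>,
    \<open>b = - \<phi>\<close>: here the eigenvalues of \<open>A\<close> are met in their given
    order.\<close>
  have lower: "- of_real \<phi> \<noteq> (0::complex)"
    "?A *v v = (- 1) *s (lowering_mat (- of_real \<phi>) *v v) - (- of_real \<phi>) *s (raising_mat (- of_real \<phi>) *v v)"
    "k \<le> N \<Longrightarrow> ?\<theta> k = (- 1 * ?q ^ k - - of_real \<phi> * ?q ^ (N - k)) / (?q - 1)" for v k
    using Amat_lower[of \<phi>] assms(5) by (auto simp: th)
  have mu: "mu CARD('f) i = ?q ^ i / (?q - 1)" by (simp add: mu_def)
  note M_upper = lowering_mat_split(2)[unfolded assms(3), OF upper inj' assms(6)]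
   and P_upper = raising_mat_split[unfolded assms(3), OF upper inj' assms(6)]
   and M_lower = lowering_mat_split(2)[unfolded assms(3), OF lower inj assms(6)]
   and P_lower = raising_mat_split[unfolded assms(3), OF lower inj assms(6)]
  have span: "(\<Sum>k=0..N. eigenspace ?A (?\<theta> k)) = UNIV"
    by (rule lowering_mat_split(1)[unfolded assms(3), OF lower inj])
  have E: "matrix_range (Emat smul sub N \<phi> j) = eigenspace ?A (?\<theta> j)" if "j \<le> N" for j
    unfolding Emat_def using inj span that by (rule matrix_range_projection)
  have sum_E: "(\<Sum>j\<in>J. matrix_range (Emat smul sub N \<phi> j)) = (\<Sum>j\<in>J. eigenspace ?A (?\<theta> j))"
    if "\<forall>j\<in>J. j \<le> N" for J
    using that E by (intro sum.cong) auto
  \<comment> \<open>Undoes the reversal of \<open>upper\<close>: \<open>m = i\<close> yields the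
    range up to \<open>N - i\<close>, and \<open>m = N - i\<close> the range up to
    \<open>i\<close>.\<close>
  have rev: "(\<Sum>k=m..N. eigenspace ?A (?\<theta> (N - k))) = (\<Sum>j=0..N-m. eigenspace ?A (?\<theta> j))"
    if "m \<le> N" for m
    by (rule sum.reindex_bij_witness[of _ "\<lambda>k. N - k" "\<lambda>k. N - k"]) (use that in auto)
  have Estar: "(\<Sum>j=0..i. matrix_range (Estar smul sub j)) = {v. \<forall>y. v $ y \<noteq> 0 \<longrightarrow> sd y \<le> i}"
    "(\<Sum>j=i..N. matrix_range (Estar smul sub j)) = {v. \<forall>y. v $ y \<noteq> 0 \<longrightarrow> i \<le> sd y}"
    using sd_le[unfolded assms(3)] by (auto simp: sum_matrix_range_Estar)
  show ?thesis
    unfolding U_dd_def U_ud_def U_du_def U_uu_def mu Estar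
      A_upper_minus_eq A_upper_plus_eq A_lower_minus_eq A_lower_plus_eq
  proof (intro conjI)
    show "eigenspace (lowering_mat 1) (?q ^ i / (?q - 1)) = {v. \<forall>y. v $ y \<noteq> 0 \<longrightarrow> sd y \<le> i}
        \<inter> (\<Sum>j=0..N-i. matrix_range (Emat smul sub N \<phi> j))"
      by (subst sum_E) (auto simp: M_upper rev[OF assms(6)])
    show "eigenspace (raising_mat 1) (?q ^ i / (?q - 1)) = {v. \<forall>y. v $ y \<noteq> 0 \<longrightarrow> i \<le> sd y}
        \<inter> (\<Sum>j=0..i. matrix_range (Emat smul sub N \<phi> j))"
      using rev[of "N - i"] assms(6) by (subst sum_E) (auto simp: P_upper)
    show "eigenspace (lowering_mat (- of_real \<phi>)) (?q ^ i / (?q - 1)) = {v. \<forall>y. v $ y \<noteq> 0 \<longrightarrow> sd y \<le> i}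
        \<inter> (\<Sum>j=i..N. matrix_range (Emat smul sub N \<phi> j))"
      by (subst sum_E) (auto simp: M_lower)
    show "eigenspace (raising_mat (- of_real \<phi>)) (?q ^ i / (?q - 1)) = {v. \<forall>y. v $ y \<noteq> 0 \<longrightarrow> i \<le> sd y}
        \<inter> (\<Sum>j=N-i..N. matrix_range (Emat smul sub N \<phi> j))"
      by (subst sum_E) (auto simp: P_lower)
  qed
qed

end
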